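(* Let $\mathbb N'$ and $\mathbb N''$ be two nonempty subsets of $\mathbb N$, and let $\mathcal V=\{V_n : n\in\mathbb N'\}$ and $\mathcal W=\{W_j : j\in\mathbb N''\}$ be two families, each consisting of pairwise disjoint nonempty connected subsets of the semi-open interval $(0,1/2]$. For each $n\in\mathbb N'$ and each $j\in\mathbb N''$, let $\omega_n: J\to\mathcal A$ and $\alpha_j: J\to\mathcal A'$ be given increasing and endpoint preserving maps. Then there exists a normally rising homeomorphism $f:J^2\to J^2$ such that $\omega_{sf}=\omega_n$ for any $n\in\mathbb N'$ and any $s\in V_n$, and $\alpha_{tf}=\alpha_j$ for any $j\in\mathbb N''$ and any $t\in W_j$.
   Context: $\mathbb N$ denotes the set of positive integers. Write $J=[-1,1]$, and for $s\in J$ let $J_s=J\times\{s\}\subset J^2$. Normally rising homeomorphisms: define the homeomorphism $f_{01}:J\to J$ by $f_{01}(s)=(s+1)/2$ if $0\le s\le 1$, $f_{01}(s)=s+1/2$ if $-1/2\le s\le 0$, and $f_{01}(s)=2s+1$ if $-1\le s\le -1/2$; define $f_{02}:J^2\to J^2$ by $f_{02}(r,s)=(r,f_{01}(s))$. A homeomorphism $f:J^2\to J^2$ is normally rising if $f|_{\partial J^2}=f_{02}|_{\partial J^2}$ (where $\partial J^2$ is the boundary of the square $J^2$) and $f(J_s)=f_{02}(J_s)$ for every $s\in J$. Limit sets: for a homeomorphism $f$ of $J^2$ and a point $x$, $\omega_f(x)$ is the set of all $y$ such that $f^{n_i}(x)\to y$ for some sequence of positive integers $n_1<n_2<\cdots$,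 and $\alpha_f(x)=\omega_{f^{-1}}(x)$. Target families: $\mathcal A$ is the family of all nonempty connected closed subsets of $J_1=J\times\{1\}$, and $\mathcal A'$ is the family of all nonempty connected closed subsets of $J_{-1}=J\times\{-1\}$. Increasing and endpoint preserving maps: let $p(r,s)=r$ be the abscissa. A map $\phi:J\to\mathcal A$ or $\phi:J\to\mathcal A'$ is increasing if $\min p(\phi(r_1))\le\min p(\phi(r_2))$ and $\max p(\phi(r_1))\le\max p(\phi(r_2))$ for all $r_1<r_2$ in $J$. A map $\phi:J\to\mathcal A$ is endpoint preserving if $\phi(-1)=\{(-1,1)\}$ and $\phi(1)=\{(1,1)\}$; a map $\phi:J\to\mathcal A'$ is endpoint preserving if $\phi(-1)=\{(-1,-1)\}$ and $\phi(1)=\{(1,-1)\}$. For a normally rising homeomorphism $f$ and $s\in(-1,1)$, the maps $\omega_{sf}:J\to\mathcal A$ and $\alpha_{sf}:J\to\mathcal A'$ are defined by $\omega_{sf}(r)=\omega_f(r,s)$ and $\alpha_{sf}(r)=\alpha_f(r,s)$ for $r\in J$ (these limit sets do belong to $\mathcal A$ and $\mathcal A'$ respectively). *)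

theory Defs
  imports "HOL-Analysis.Analysis"
begin

definition J :: "real set" where
  "J = {-1..1}"

definition J2 :: "(real \<times> real) set" where
  "J2 = J \<times> J"

definition level :: "real \<Rightarrow> (real \<times> real) set" where
  "level s = J \<times> {s}"

text \<open>Maps on \<open>J\<close> and \<open>J2\<close> are total functions whose values outside \<open>J\<close> and \<open>J2\<close> are
  irrelevant.\<close>

definition f01 :: "real \<Rightarrow> real" where
  "f01 s = (if 0 \<le> s then (s + 1) / 2
            else if -1/2 \<le> s then s + 1/2
            else 2 * s + 1)"

definition f02 :: "real \<times> real \<Rightarrow> real \<times> real" where
  "f02 = (\<lambda>(r, s). (r, f01 s))"

definition normally_rising :: "(real \<times> real \<Rightarrow> real \<times> real) \<Rightarrow> bool" where
  "normally_rising f \<longleftrightarrow>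
     (\<exists>g. homeomorphism J2 J2 f g) \<and>
     (\<forall>x\<in>frontier J2. f x = f02 x) \<and>
     (\<forall>s\<in>J. f ` level s = f02 ` level s)"

definition omega_limit :: "('a::topological_space \<Rightarrow> 'a) \<Rightarrow> 'a \<Rightarrow> 'a set" where
  "omega_limit f x =
     {y. \<exists>n :: nat \<Rightarrow> nat. strict_mono n \<and> (\<forall>i. 0 < n i) \<and> (\<lambda>i. (f ^^ n i) x) \<longlonglongrightarrow> y}"

text \<open>The inverse is that of \<open>f\<close> as a self-map of \<open>J2\<close>, hence \<open>inv_into J2 f\<close> and not \<open>inv f\<close>.\<close>

definition alpha_limit :: "(real \<times> real \<Rightarrow> real \<times> real) \<Rightarrow> real \<times> real \<Rightarrow> (real \<times> real) set" where
  "alpha_limit f x = omega_limit (inv_into J2 f) x"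

definition omega_slice :: "real \<Rightarrow> (real \<times> real \<Rightarrow> real \<times> real) \<Rightarrow> real \<Rightarrow> (real \<times> real) set" where
  "omega_slice s f r = omega_limit f (r, s)"

definition alpha_slice :: "real \<Rightarrow> (real \<times> real \<Rightarrow> real \<times> real) \<Rightarrow> real \<Rightarrow> (real \<times> real) set" where
  "alpha_slice s f r = alpha_limit f (r, s)"

text \<open>The target families \<open>\<A>\<close> and \<open>\<A>'\<close> are \<open>level_continua 1\<close> and \<open>level_continua (-1)\<close>.
  As \<open>level c\<close> is closed in the plane, closed in \<open>level c\<close> and closed in the plane agree.\<close>

definition level_continua :: "real \<Rightarrow> (real \<times> real) set set" where
  "level_continua c = {A. A \<noteq> {} \<and> connected A \<and> closed A \<and> A \<subseteq> level c}"

text \<open>For members of \<open>level_continua c\<close>, which are nonempty and compact, \<open>Inf\<close> and \<open>Sup\<close> of the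
  set of abscissas are its minimum and maximum (\<open>Min\<close> and \<open>Max\<close> only apply to finite sets).\<close>

definition increasing_map :: "(real \<Rightarrow> (real \<times> real) set) \<Rightarrow> bool" where
  "increasing_map \<phi> \<longleftrightarrow>
     (\<forall>r1\<in>J. \<forall>r2\<in>J. r1 < r2 \<longrightarrow>
        Inf (fst ` \<phi> r1) \<le> Inf (fst ` \<phi> r2) \<and> Sup (fst ` \<phi> r1) \<le> Sup (fst ` \<phi> r2))"

definition endpoint_preserving :: "real \<Rightarrow> (real \<Rightarrow> (real \<times> real) set) \<Rightarrow> bool" where
  "endpoint_preserving c \<phi> \<longleftrightarrow> \<phi> (-1) = {(-1, c)} \<and> \<phi> 1 = {(1, c)}"

end

theory Submission imports Defs begin

text \<open>Let \<open>Q s\<close> (\<open>-1 < s < 1\<close>) be increasing homeomorphisms of \<open>J\<close>, jointly continuous, with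
  \<open>Q s = id\<close> for \<open>\<bar>s\<bar> \<le> 1/2\<close> and \<open>\<bar>Q (f01 s) - Q s\<bar> \<rightarrow> 0\<close> as \<open>\<bar>s\<bar> \<rightarrow> 1\<close>. Conjugating \<open>f02\<close>
  by \<open>(r, s) \<mapsto> (Q s r, s)\<close> gives a map that extends to a normally rising homeomorphism, and the
  orbit of a point \<open>(r, s)\<close> with \<open>0 < s \<le> 1/2\<close> is \<open>(Q s' r, s')\<close>, where \<open>s'\<close> runs through
  the \<open>f01\<close>-orbit of \<open>s\<close>. The levels \<open>s > 0\<close> thus control the \<open>\<omega>\<close>-limits and, since
  \<open>f01\<inverse> s = - f01 (- s)\<close>, the levels \<open>s \<le> 0\<close> control the \<open>\<alpha>\<close>-limits in the same way.

  To realise limit sets \<open>[a r, b r]\<close>, approximate the monotone functions \<open>a\<close> and \<open>b\<close> pointwise by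
  increasing homeomorphisms and oscillate ever more slowly between the approximants: since the
  increments tend to \<open>0\<close>, the cluster set is the whole interval. Different families on the
  disjoint sets \<open>V n\<close> are treated at once by exhausting each \<open>V n\<close> by compact sets and by
  interpolating at stage \<open>m\<close> between the targets on the first \<open>m\<close> of them.\<close>

subsection \<open>Increasing homeomorphisms of the interval\<close>

text \<open>With the endpoints fixed, continuity gives surjectivity onto \<open>J\<close> by the
  intermediate value theorem, so these are exactly the orientation preserving self-homeomorphisms of
  \<open>J\<close>. Values outside \<open>J\<close> are unconstrained.\<close>

definition incr_homeo :: "(real \<Rightarrow> real) \<Rightarrow> bool" where
  "incr_homeo g \<longleftrightarrow> continuous_on J g \<and> strict_mono_on J g \<and> g (-1) = -1 \<and> g 1 = 1"

lemma incr_homeo_id: "incr_homeo (\<lambda>r. r)"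
  by (auto simp: incr_homeo_def intro: strict_mono_onI)

lemma incr_homeo_mem:
  assumes "incr_homeo g" "r \<in> J"
  shows "g r \<in> J"
proof -
  have "mono_on J g"
    using assms(1) by (auto simp: incr_homeo_def strict_mono_on_imp_mono_on)
  then have "g (-1) \<le> g r" "g r \<le> g 1"
    using assms(2) by (auto simp: mono_on_def J_def)
  then show ?thesis
    using assms(1) by (simp add: incr_homeo_def J_def)
qed

lemma incr_homeo_image:
  assumes "incr_homeo g"
  shows "g ` J = J"
proof
  show "g ` J \<subseteq> J"
    using incr_homeo_mem[OF assms] by auto
  have "\<exists>x\<ge>-1. x \<le> 1 \<and> g x = y" if "y \<in> J" for y
    using assms that by (intro IVT') (auto simp: incr_homeo_def J_def)
  then show "J \<subseteq> g ` J"
    by (force simp: J_def)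
qed

lemma incr_homeo_inj:
  assumes "incr_homeo g"
  shows "inj_on g J"
  using assms by (auto simp: incr_homeo_def strict_mono_on_imp_inj_on)

section \<open>Approximation of monotone functions by increasing homeomorphisms\<close>

lemma continuous_on_Min_image:
  fixes h :: "'b \<Rightarrow> 'a::topological_space \<Rightarrow> real"
  assumes "finite F" "F \<noteq> {}" "\<And>d. d \<in> F \<Longrightarrow> continuous_on S (h d)"
  shows "continuous_on S (\<lambda>r. Min ((\<lambda>d. h d r) ` F))"
  using assms by (induction F rule: finite_ne_induct) (auto intro: continuous_on_min)

text \<open>The function \<open>r \<mapsto> min\<^sub>d (a d + L max(0, r - d))\<close> is a one-sided McShane extension: its
  terms are increasing in \<open>r\<close>, and a large \<open>L\<close> makes it agree with \<open>a\<close> on \<open>F\<close>.\<close>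

lemma finite_mono_interpolation:
  fixes a :: "real \<Rightarrow> real"
  assumes F: "finite F" "F \<noteq> {}" and a: "mono_on F a"
  shows "\<exists>g. continuous_on UNIV g \<and> mono g \<and> (\<forall>d\<in>F. g d = a d)"
proof -
  \<comment> \<open>The largest difference quotient of \<open>a\<close> on \<open>F\<close>;
    diagonal pairs contribute 0 because division by 0 gives 0.\<close>
  define L where "L = Max ((\<lambda>(d, e). \<bar>(a d - a e) / (d - e)\<bar>) ` (F \<times> F))"
  have L: "\<bar>(a d - a e) / (d - e)\<bar> \<le> L" if "d \<in> F" "e \<in> F" for d e
    unfolding L_def using that F by (intro Max_ge) (auto intro!: image_eqI[of _ _ "(d, e)"])
  have L0: "L \<ge> 0"
    using L F(2) abs_ge_zero order_trans by blast
  define h where "h = (\<lambda>d r. a d + L * max 0 (r - d))"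
  define g where "g = (\<lambda>r. Min ((\<lambda>d. h d r) ` F))"
  have "continuous_on UNIV g"
    unfolding g_def by (intro continuous_on_Min_image F) (auto simp: h_def intro!: continuous_intros)
  moreover have "mono g"
  proof
    fix x y :: real assume "x \<le> y"
    then have "h d x \<le> h d y" for d
      using L0 by (auto simp: h_def intro!: mult_left_mono)
    then show "g x \<le> g y"
      unfolding g_def using F by (auto simp: Min_le_iff intro!: Min.boundedI)
  qed
  moreover have "g d = a d" if d: "d \<in> F" for d
  proof (rule antisym)
    have "g d \<le> h d d"
      unfolding g_def using F d by (intro Min_le) auto
    then show "g d \<le> a d"
      by (simp add: h_def)
    have "a d \<le> h e d" if e: "e \<in> F" for e
    proof (cases "d \<le> e")
      case True
      then show ?thesis
        using a d e by (auto simp: h_def mono_on_def)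
    next
      case False
      then have "(a d - a e) / (d - e) \<le> L"
        using L[OF d e] by linarith
      then show ?thesis
        using False by (simp add: h_def field_simps)
    qed
    then show "a d \<le> g d"
      unfolding g_def using F by auto
  qed
  ultimately show ?thesis
    by blast
qed

text \<open>Interpolate \<open>a\<close> at more and more points of a countable set \<open>D\<close>
  that is dense in \<open>J\<close> and contains the countably many discontinuities of
  \<open>a\<close>. At points of \<open>D\<close> the values are eventually exact; at the others
  \<open>a\<close> is continuous, and monotonicity squeezes the approximants between neighbouring
  points of \<open>D\<close>.\<close>

lemma mono_on_seq_approx:
  assumes a: "mono_on J a" and a1: "a (-1) = -1" "a 1 = 1"
  shows "\<exists>g. (\<forall>m::nat. incr_homeo (g m)) \<and> (\<forall>r\<in>J. (\<lambda>m. g m r) \<longlonglongrightarrow> a r)"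
proof -
  obtain D0 :: "real set" where D0: "countable D0" "\<And>x y. x < y \<Longrightarrow> \<exists>d\<in>D0. x < d \<and> d < y"
    using countable_dense_setE[where 'a=real] by (metis greaterThanLessThan_iff greaterThanLessThan_empty_iff leD open_greaterThanLessThan)
  define D where "D = (D0 \<inter> J) \<union> {r\<in>J. \<not> continuous (at r within J) a} \<union> {-1, 1}"
  have "countable D"
    unfolding D_def using D0(1) mono_on_ctble_discont[OF a] by simp
  then obtain d :: "nat \<Rightarrow> real" where d: "range d = D"
    by (metis D_def UnI2 empty_iff insertI1 uncountable_def)
  define F where "F = (\<lambda>m::nat. insert (-1) (insert 1 (d ` {..m})))"
  have DJ: "D \<subseteq> J"
    by (auto simp: D_def J_def)
  have FJ: "F m \<subseteq> J" for m
    using d DJ by (auto simp: F_def J_def)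
  have "\<exists>h. continuous_on UNIV h \<and> mono h \<and> (\<forall>x\<in>F m. h x = a x)" for m
    by (rule finite_mono_interpolation) (auto simp: F_def mono_on_subset[OF a FJ[of m, unfolded F_def]])
  then obtain h where h: "\<And>m. continuous_on UNIV (h m)" "\<And>m. mono (h m)"
      "\<And>m x. x \<in> F m \<Longrightarrow> h m x = a x"
    by metis
  \<comment> \<open>A vanishing share of the identity makes the monotone interpolants strictly
    monotone and still fixes -1 and 1.\<close>
  define t where "t = (\<lambda>m. inverse (real (Suc m)))"
  define g where "g = (\<lambda>m r. (1 - t m) * h m r + t m * r)"
  have t: "0 < t m" "t m \<le> 1" for m
    by (auto simp: t_def field_simps)
  have t0: "t \<longlonglongrightarrow> 0"
    unfolding t_def by (rule LIMSEQ_inverse_real_of_nat)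
  have "incr_homeo (g m)" for m
  proof -
    have "continuous_on J (g m)"
      unfolding g_def by (intro continuous_intros continuous_on_subset[OF h(1)]) auto
    moreover have "strict_mono_on J (g m)"
    proof (rule strict_mono_onI)
      fix r s :: real assume "r < s"
      then have "h m r \<le> h m s"
        using h(2)[of m] by (simp add: mono_def)
      then have "(1 - t m) * h m r \<le> (1 - t m) * h m s" "t m * r < t m * s"
        using t[of m] \<open>r < s\<close> by (auto intro: mult_left_mono)
      then show "g m r < g m s"
        by (simp add: g_def)
    qed
    moreover have "h m (-1) = -1" "h m 1 = 1"
      using h(3)[of _ m] a1 by (auto simp: F_def)
    ultimately show ?thesis
      by (auto simp: incr_homeo_def g_def)
  qed
  moreover have "(\<lambda>m. g m r) \<longlonglongrightarrow> a r" if r: "r \<in> J" for r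
  proof -
    have hD: "\<forall>\<^sub>F m in sequentially. h m x = a x" if xD: "x \<in> D" for x
    proof -
      obtain k where "d k = x" using d xD by auto
      then have "x \<in> F m" if "m \<ge> k" for m using that by (auto simp: F_def)
      then show ?thesis using h(3) unfolding eventually_sequentially by blast
    qed
    have "(\<lambda>m. h m r) \<longlonglongrightarrow> a r"
    proof (cases "r \<in> D")
      case True
      then show ?thesis using hD by (simp add: tendsto_eventually)
    next
      case False
      then have cont: "continuous (at r within J) a" and r1: "-1 < r" "r < 1"
        using r by (auto simp: D_def J_def order.order_iff_strict)
      show ?thesis
      proof (rule tendstoI)
        fix e :: real assume "e > 0"
        then obtain \<delta> where \<delta>: "\<delta> > 0" "\<And>x. x \<in> J \<Longrightarrow> dist x r < \<delta> \<Longrightarrow> dist (a x) (a r) < e"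
          using cont by (auto simp: continuous_within_eps_delta)
        \<comment> \<open>Two points of \<open>D\<close> around \<open>r\<close>, within \<delta> of
          it, trap \<open>h m r\<close> as soon as \<open>h m\<close> is exact at both.\<close>
        obtain x where x: "x \<in> D0" "max (-1) (r - \<delta>) < x" "x < r"
          using D0(2)[of "max (-1) (r - \<delta>)" r] r1 \<delta>(1) by auto
        obtain y where y: "y \<in> D0" "r < y" "y < min 1 (r + \<delta>)"
          using D0(2)[of r "min 1 (r + \<delta>)"] r1 \<delta>(1) by auto
        have xy: "x \<in> J" "y \<in> J"
          using x y r1 by (auto simp: J_def)
        then have "x \<in> D" "y \<in> D"
          using x y by (auto simp: D_def)
        then have "\<forall>\<^sub>F m in sequentially. h m x = a x \<and> h m y = a y"
          using hD by (auto intro: eventually_conj)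
        then show "\<forall>\<^sub>F m in sequentially. dist (h m r) (a r) < e"
        proof eventually_elim
          case (elim m)
          have "a x \<le> h m r" "h m r \<le> a y"
            using elim h(2)[of m] x y by (metis less_imp_le monoD)+
          moreover have "dist (a x) (a r) < e" "dist (a y) (a r) < e"
            using \<delta>(2) xy x y by (auto simp: dist_real_def)
          ultimately show ?case
            by (auto simp: dist_real_def)
        qed
      qed
    qed
    then have "(\<lambda>m. (1 - t m) * h m r + t m * r) \<longlonglongrightarrow> (1 - 0) * a r + 0 * r"
      by (intro tendsto_intros t0)
    then show ?thesis
      by (simp add: g_def)
  qed
  ultimately show ?thesis
    by blast
qed

subsection \<open>Piecewise linear interpolation of a sequence\<close>

definition ramp :: "real \<Rightarrow> real" where
  "ramp x = min 1 (max 0 x)"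

text \<open>The piecewise linear function with value \<open>c n\<close> at \<open>n\<close>, written
  as a sum of ramps so that Lipschitz bounds and continuity in parameters can be proved
  termwise.\<close>

definition interp :: "(nat \<Rightarrow> real) \<Rightarrow> real \<Rightarrow> real" where
  "interp c x = c 0 + (\<Sum>j<nat \<lceil>x\<rceil>. ramp (x - real j) * (c (Suc j) - c j))"

text \<open>Ramps starting at or after \<open>x\<close> vanish, so one bound \<open>N\<close> serves
  several arguments at once.\<close>

lemma interp_eq:
  assumes "x \<le> real N"
  shows "interp c x = c 0 + (\<Sum>j<N. ramp (x - real j) * (c (Suc j) - c j))"
proof -
  have "nat \<lceil>x\<rceil> \<le> N"
    using assms by (simp add: nat_le_iff ceiling_le_iff)
  moreover have "ramp (x - real j) = 0" if "j \<in> {..<N} - {..<nat \<lceil>x\<rceil>}" for j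
  proof -
    have "x \<le> real j"
      using that by (auto simp: not_less nat_le_iff ceiling_le_iff)
    then show ?thesis
      by (simp add: ramp_def)
  qed
  ultimately show ?thesis
    unfolding interp_def by (intro arg_cong2[where f = "(+)"] sum.mono_neutral_left) auto
qed

text \<open>The ramps before \<open>n\<close> are saturated at 1 and their sum telescopes; only the
  ramp at \<open>n\<close> is partial.\<close>

lemma interp_segment:
  assumes "real n \<le> x" "x \<le> real (Suc n)"
  shows "interp c x = (1 - (x - real n)) * c n + (x - real n) * c (Suc n)"
proof -
  have "interp c x = c 0 + (\<Sum>j<n. ramp (x - real j) * (c (Suc j) - c j))
      + ramp (x - real n) * (c (Suc n) - c n)"
    using interp_eq[OF assms(2)] by simp
  also have "(\<Sum>j<n. ramp (x - real j) * (c (Suc j) - c j)) = (\<Sum>j<n. c (Suc j) - c j)"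
    using assms by (intro sum.cong) (auto simp: ramp_def)
  also have "\<dots> = c n - c 0"
    by (rule sum_lessThan_telescope)
  also have "ramp (x - real n) = x - real n"
    using assms by (simp add: ramp_def)
  finally show ?thesis
    by (simp add: algebra_simps)
qed

lemma interp_segmentE:
  assumes "0 \<le> x"
  obtains n where "real n \<le> x" "x \<le> real (Suc n)"
    "\<And>c. interp c x = (1 - (x - real n)) * c n + (x - real n) * c (Suc n)"
proof -
  have "real (nat \<lfloor>x\<rfloor>) \<le> x" "x \<le> real (Suc (nat \<lfloor>x\<rfloor>))"
    using assms by linarith+
  with interp_segment that show ?thesis
    by blast
qed

lemma interp_nat [simp]: "interp c (real n) = c n"
  using interp_segment[of n "real n" c] by simp

lemma interp_const:
  assumes "0 \<le> x"
  shows "interp (\<lambda>n. k) x = k"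
proof -
  obtain n where "\<And>c. interp c x = (1 - (x - real n)) * c n + (x - real n) * c (Suc n)"
    using interp_segmentE[OF assms] by blast
  from this[of "\<lambda>n. k"] show ?thesis
    by (simp add: algebra_simps)
qed

text \<open>Only indices \<open>n > x - 1\<close> are compared, so bounds that hold from some index
  on can be used for large \<open>x\<close>.\<close>

lemma interp_mono:
  assumes "0 \<le> x" "\<And>n. x < real n + 1 \<Longrightarrow> c n \<le> d n"
  shows "interp c x \<le> interp d x"
proof -
  obtain n where n: "real n \<le> x" "x \<le> real (Suc n)"
    "\<And>c. interp c x = (1 - (x - real n)) * c n + (x - real n) * c (Suc n)"
    using interp_segmentE[OF assms(1)] by blast
  show ?thesis
  proof (cases "x < real n + 1")
    case True
    then show ?thesis
      using n assms(2)[of n] assms(2)[of "Suc n"] unfolding n(3)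
      by (intro add_mono mult_left_mono) auto
  next
    case False
    then have "x = real (Suc n)" using n by simp
    then show ?thesis using assms(2)[of "Suc n"] by (metis interp_nat less_add_one)
  qed
qed

lemma interp_strict_mono:
  assumes "0 \<le> x" "\<And>n. c n < d n"
  shows "interp c x < interp d x"
proof -
  obtain n where n: "real n \<le> x" "x \<le> real (Suc n)"
    "\<And>c. interp c x = (1 - (x - real n)) * c n + (x - real n) * c (Suc n)"
    using interp_segmentE[OF assms(1)] by blast
  show ?thesis
  proof (cases "x = real n")
    case True
    then show ?thesis using assms(2) by simp
  next
    case False
    then have "(x - real n) * c (Suc n) < (x - real n) * d (Suc n)"
      using n assms(2) by simp
    moreover have "(1 - (x - real n)) * c n \<le> (1 - (x - real n)) * d n"
      using n assms(2)[of n] by (intro mult_left_mono) auto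
    ultimately show ?thesis
      unfolding n(3) by linarith
  qed
qed

text \<open>The difference is a sum of ramp increments of constant sign times steps of
  \<open>c\<close>. Bounding each step by \<open>B\<close> leaves \<open>B\<close> times the same
  sum for the sequence \<open>real\<close>, whose interpolation is the identity.\<close>

lemma interp_Lipschitz:
  assumes "0 \<le> x" "0 \<le> y" and c: "\<And>n. \<bar>c (Suc n) - c n\<bar> \<le> B"
  shows "\<bar>interp c x - interp c y\<bar> \<le> B * \<bar>x - y\<bar>"
  using assms(1,2)
proof (induction x y rule: linorder_wlog)
  case (sym x y)
  then show ?case by (simp add: abs_minus_commute)
next
  case (le x y)
  obtain N where N: "y \<le> real N"
    using real_arch_simple by blast
  then have x: "x \<le> real N"
    using le by simp
  have interp_id: "interp real z = z" if z: "0 \<le> z" for z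
  proof -
    obtain n where "\<And>c. interp c z = (1 - (z - real n)) * c n + (z - real n) * c (Suc n)"
      using interp_segmentE[OF z] by blast
    from this[of real] show ?thesis
      by (simp add: algebra_simps)
  qed
  have "\<bar>interp c x - interp c y\<bar>
      = \<bar>\<Sum>j<N. (ramp (y - real j) - ramp (x - real j)) * (c (Suc j) - c j)\<bar>"
    unfolding interp_eq[OF x] interp_eq[OF N]
    by (subst abs_minus_commute) (simp add: sum_subtractf left_diff_distrib)
  also have "\<dots> \<le> (\<Sum>j<N. (ramp (y - real j) - ramp (x - real j)) * B)"
  proof (rule order_trans[OF sum_abs], rule sum_mono)
    fix j
    have "ramp (x - real j) \<le> ramp (y - real j)"
      using le by (auto simp: ramp_def)
    then show "\<bar>(ramp (y - real j) - ramp (x - real j)) * (c (Suc j) - c j)\<bar>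
        \<le> (ramp (y - real j) - ramp (x - real j)) * B"
      using c[of j] by (simp add: abs_mult mult_left_mono)
  qed
  also have "\<dots> = B * (interp real y - interp real x)"
    unfolding interp_eq[OF x] interp_eq[OF N]
    by (simp add: sum_subtractf sum_distrib_left algebra_simps)
  also have "\<dots> = B * \<bar>x - y\<bar>"
    using le by (simp add: interp_id)
  finally show ?case .
qed

text \<open>Near each point \<phi> stays below some \<open>N\<close>, and there the interpolation is
  a fixed finite sum of continuous functions.\<close>

lemma continuous_on_interp:
  fixes \<phi> :: "'a::topological_space \<Rightarrow> real"
  assumes c: "\<And>n. continuous_on S (c n)" and \<phi>: "continuous_on S \<phi>"
  shows "continuous_on S (\<lambda>p. interp (\<lambda>n. c n p) (\<phi> p))"
  unfolding continuous_on_def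
proof
  fix p assume p: "p \<in> S"
  obtain N where N: "\<phi> p < real N"
    using reals_Archimedean2 by blast
  define F where "F = (\<lambda>p. c 0 p + (\<Sum>j<N. ramp (\<phi> p - real j) * (c (Suc j) p - c j p)))"
  have "continuous_on S F"
    unfolding F_def ramp_def by (intro continuous_intros c \<phi>)
  then have "(F \<longlongrightarrow> F p) (at p within S)"
    using p by (simp add: continuous_on_def)
  moreover have "(\<phi> \<longlongrightarrow> \<phi> p) (at p within S)"
    using \<phi> p by (simp add: continuous_on_def)
  then have "\<forall>\<^sub>F q in at p within S. \<phi> q < real N"
    using N by (rule order_tendstoD)
  then have "\<forall>\<^sub>F q in at p within S. F q = interp (\<lambda>n. c n q) (\<phi> q)"
    by eventually_elim (simp add: F_def interp_eq[OF less_imp_le])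
  ultimately have "((\<lambda>p. interp (\<lambda>n. c n p) (\<phi> p)) \<longlongrightarrow> F p) (at p within S)"
    by (rule Lim_transform_eventually)
  moreover have "F p = interp (\<lambda>n. c n p) (\<phi> p)"
    using N by (simp add: F_def interp_eq[OF less_imp_le])
  ultimately show "((\<lambda>p. interp (\<lambda>n. c n p) (\<phi> p)) \<longlongrightarrow> interp (\<lambda>n. c n p) (\<phi> p)) (at p within S)"
    by simp
qed

section \<open>Cluster sets of sequences with vanishing increments\<close>

definition cluster_set :: "(nat \<Rightarrow> real) \<Rightarrow> real set" where
  "cluster_set u = {y. \<forall>\<epsilon>>0. \<exists>\<^sub>F k in sequentially. \<bar>u k - y\<bar> < \<epsilon>}"

text \<open>A sequence with vanishing increments has every value between two of its cluster points as a
  cluster point.\<close>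

lemma frequently_between:
  fixes u :: "nat \<Rightarrow> real"
  assumes inc: "(\<lambda>k. u (Suc k) - u k) \<longlonglongrightarrow> 0" and e: "e > 0"
    and lo: "\<exists>\<^sub>F k in sequentially. u k < y + e"
    and hi: "\<exists>\<^sub>F k in sequentially. u k > y - e"
  shows "\<exists>\<^sub>F k in sequentially. \<bar>u k - y\<bar> < e"
proof (rule ccontr)
  assume "\<not> ?thesis"
  then have "\<forall>\<^sub>F k in sequentially. e \<le> \<bar>u k - y\<bar>"
    by (simp add: not_frequently not_less)
  moreover have "\<forall>\<^sub>F k in sequentially. \<bar>u (Suc k) - u k\<bar> < e"
    using tendstoD[OF inc e] by (simp add: dist_real_def)
  ultimately obtain K where K: "\<And>k. k \<ge> K \<Longrightarrow> e \<le> \<bar>u k - y\<bar>" "\<And>k. k \<ge> K \<Longrightarrow> \<bar>u (Suc k) - u k\<bar> < e"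
    by (metis (no_types, lifting) eventually_conj_iff eventually_sequentially)
  obtain k1 where k1: "k1 \<ge> K" "u k1 > y - e"
    using hi unfolding frequently_sequentially by blast
  \<comment> \<open>A step shorter than \<open>e\<close> cannot cross the avoided interval of radius
    \<open>e\<close> around \<open>y\<close>, so the sequence stays above it.\<close>
  have "u k > y - e" if "k \<ge> k1" for k
    using that
  proof (induction k rule: dec_induct)
    case base
    show ?case using k1 by simp
  next
    case (step k)
    then show ?case using K(1)[of k] K(2)[of k] k1(1) K(1)[of "Suc k"] by fastforce
  qed
  moreover obtain k2 where k2: "k2 \<ge> k1" "u k2 < y + e"
    using lo unfolding frequently_sequentially by blast
  ultimately show False
    using K(1)[of k2] k1(1) by fastforce
qed

text \<open>The Lipschitz bound transfers vanishing increments from \<open>x\<close> to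
  \<open>u\<close>. Since \<open>x\<close> passes close to every large integer, \<open>u\<close>
  comes close to the even and the odd entries of \<open>e\<close>, so \<open>a\<close> and
  \<open>b\<close> are cluster points and everything between them is too. Conversely, all late
  values of \<open>u\<close> lie within \<epsilon> of \<open>{a..b}\<close>.\<close>

lemma interp_cluster:
  fixes e :: "nat \<Rightarrow> real"
  assumes e: "\<And>n. \<bar>e (Suc n) - e n\<bar> \<le> B"
    and ea: "(\<lambda>m. e (2 * m)) \<longlonglongrightarrow> a" and eb: "(\<lambda>m. e (Suc (2 * m))) \<longlonglongrightarrow> b" and ab: "a \<le> b"
    and x0: "\<And>k. 0 \<le> x k" and x: "filterlim x at_top sequentially"
    and inc: "(\<lambda>k. x (Suc k) - x k) \<longlonglongrightarrow> 0"
  shows "cluster_set (\<lambda>k. interp e (x k)) = {a..b}"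
proof -
  define u where "u = (\<lambda>k. interp e (x k))"
  have B: "B \<ge> 0"
    using e[of 0] by linarith
  have Lip: "\<bar>interp e s - interp e t\<bar> \<le> B * \<bar>s - t\<bar>" if "0 \<le> s" "0 \<le> t" for s t
    using interp_Lipschitz[where c = e and B = B, OF that e] .
  have uinc: "(\<lambda>k. u (Suc k) - u k) \<longlonglongrightarrow> 0"
  proof (rule Lim_null_comparison)
    show "\<forall>\<^sub>F k in sequentially. norm (u (Suc k) - u k) \<le> B * \<bar>x (Suc k) - x k\<bar>"
      using Lip x0 by (simp add: u_def)
    show "(\<lambda>k. B * \<bar>x (Suc k) - x k\<bar>) \<longlonglongrightarrow> 0"
      using tendsto_mult_right_zero[OF tendsto_rabs_zero[OF inc]] .
  qed
  have near: "\<exists>\<^sub>F k in sequentially. \<bar>u k - l\<bar> < \<epsilon>"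
    if l: "(\<lambda>m. e (q m)) \<longlonglongrightarrow> l" and q: "\<And>m. m \<le> q m" and \<epsilon>: "\<epsilon> > 0" for l \<epsilon> and q :: "nat \<Rightarrow> nat"
    unfolding frequently_sequentially
  proof
    fix K0
    \<comment> \<open>The summand 1 keeps the denominator positive when
      \<open>B = 0\<close>.\<close>
    define \<delta> where "\<delta> = \<epsilon> / (2 * (B + 1))"
    have \<delta>: "\<delta> > 0" "B * \<delta> < \<epsilon> / 2"
      using B \<epsilon> by (auto simp: \<delta>_def field_simps)
    obtain K1 where K1: "\<And>k. k \<ge> K1 \<Longrightarrow> \<bar>x (Suc k) - x k\<bar> < \<delta>"
      using tendstoD[OF inc \<delta>(1)] by (auto simp: eventually_sequentially dist_real_def)
    define K where "K = max K0 K1"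
    obtain M where M: "\<And>m. m \<ge> M \<Longrightarrow> \<bar>e (q m) - l\<bar> < \<epsilon> / 2"
      using tendstoD[OF l, of "\<epsilon> / 2"] \<epsilon> by (auto simp: eventually_sequentially dist_real_def)
    obtain m0 where m0: "x K < real m0"
      using reals_Archimedean2 by blast
    define m where "m = max M m0"
    have qm: "x K < real (q m)" "\<bar>e (q m) - l\<bar> < \<epsilon> / 2"
      using M[of m] q[of m] m0 by (auto simp: m_def intro: less_le_trans)
    obtain k1 where k1: "\<And>k. k \<ge> k1 \<Longrightarrow> real (q m) \<le> x k"
      using x unfolding filterlim_at_top eventually_sequentially by blast
    \<comment> \<open>The first index from \<open>K\<close> on at which \<open>x\<close> has reached
      \<open>q m\<close>. As \<open>x K < q m\<close>, its predecessor is still below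
      \<open>q m\<close>, so the overshoot is less than one step, hence less than \<delta>.\<close>
    define k where "k = (LEAST k. k \<ge> K \<and> real (q m) \<le> x k)"
    have k: "k \<ge> K \<and> real (q m) \<le> x k"
      unfolding k_def by (rule LeastI[of _ "max K k1"]) (use k1[of "max K k1"] in auto)
    then have "k > K"
      using qm(1) by (cases "k = K") auto
    then obtain k' where k': "k = Suc k'" "k' \<ge> K"
      by (cases k) auto
    then have "x k' < real (q m)"
      using not_less_Least[of k' "\<lambda>k. k \<ge> K \<and> real (q m) \<le> x k"] unfolding k_def[symmetric] by auto
    then have "\<bar>x k - real (q m)\<bar> < \<delta>"
      using k k' K1[of k'] by (auto simp: K_def)
    then have "B * \<bar>x k - real (q m)\<bar> \<le> B * \<delta>"
      using B by (intro mult_left_mono) auto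
    then have "\<bar>u k - e (q m)\<bar> < \<epsilon> / 2"
      using Lip[of "x k" "real (q m)"] x0 \<delta>(2) by (simp add: u_def)
    then have "\<bar>u k - l\<bar> < \<epsilon>"
      using qm(2) by linarith
    then show "\<exists>k\<ge>K0. \<bar>u k - l\<bar> < \<epsilon>"
      using k by (auto simp: K_def)
  qed
  have "y \<in> {a..b}" if y: "\<And>\<epsilon>. \<epsilon> > 0 \<Longrightarrow> \<exists>\<^sub>F k in sequentially. \<bar>u k - y\<bar> < \<epsilon>" for y
  proof -
    have *: "a - 2 * \<epsilon> < y \<and> y < b + 2 * \<epsilon>" if \<epsilon>: "\<epsilon> > 0" for \<epsilon>
    proof -
      have "\<forall>\<^sub>F m in sequentially. \<bar>e (2 * m) - a\<bar> < \<epsilon> \<and> \<bar>e (Suc (2 * m)) - b\<bar> < \<epsilon>"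
        using tendstoD[OF ea \<epsilon>] tendstoD[OF eb \<epsilon>] by (simp add: dist_real_def eventually_conj)
      then obtain M where M: "\<And>m. m \<ge> M \<Longrightarrow> \<bar>e (2 * m) - a\<bar> < \<epsilon> \<and> \<bar>e (Suc (2 * m)) - b\<bar> < \<epsilon>"
        unfolding eventually_sequentially by blast
      have eM: "a - \<epsilon> \<le> e n \<and> e n \<le> b + \<epsilon>" if "n \<ge> 2 * M" for n
      proof -
        have "n = 2 * (n div 2) \<or> n = Suc (2 * (n div 2))" "n div 2 \<ge> M"
          using that by presburger+
        then show ?thesis
          using M[of "n div 2"] ab by (smt (verit, best))
      qed
      have "\<forall>\<^sub>F k in sequentially. real (2 * M + 1) \<le> x k"
        using x unfolding filterlim_at_top by blast
      then have "\<exists>\<^sub>F k in sequentially. \<bar>u k - y\<bar> < \<epsilon> \<and> real (2 * M + 1) \<le> x k"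
        using y[OF \<epsilon>] by (simp add: frequently_eventually_frequently)
      then obtain k where k: "\<bar>u k - y\<bar> < \<epsilon>" "real (2 * M + 1) \<le> x k"
        by (metis (mono_tags, lifting) frequently_ex)
      \<comment> \<open>As \<open>x k\<close> is at least \<open>2 * M + 1\<close>,
        \<open>interp_mono\<close> asks only about indices above \<open>2 * M\<close>, which
        \<open>eM\<close> covers.\<close>
      have "interp (\<lambda>n. a - \<epsilon>) (x k) \<le> u k" "u k \<le> interp (\<lambda>n. b + \<epsilon>) (x k)"
        unfolding u_def using eM k(2) by (auto intro!: interp_mono x0)
      then show ?thesis
        using k(1) x0[of k] unfolding interp_const[OF x0] by linarith
    qed
    have "a \<le> y"
      using *[of "(a - y) / 4"] by argo
    moreover have "y \<le> b"
      using *[of "(y - b) / 4"] by argo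
    ultimately show ?thesis by simp
  qed
  moreover have "\<exists>\<^sub>F k in sequentially. \<bar>u k - y\<bar> < \<epsilon>" if y: "y \<in> {a..b}" and \<epsilon>: "\<epsilon> > 0" for y \<epsilon>
  proof (rule frequently_between[OF uinc \<epsilon>])
    show "\<exists>\<^sub>F k in sequentially. u k < y + \<epsilon>"
      by (rule frequently_mono[OF _ near[OF ea _ \<epsilon>]]) (use y in auto)
    show "\<exists>\<^sub>F k in sequentially. u k > y - \<epsilon>"
      by (rule frequently_mono[OF _ near[OF eb _ \<epsilon>]]) (use y in auto)
  qed
  ultimately show ?thesis
    unfolding u_def cluster_set_def by blast
qed

subsection \<open>Slow isotopies with prescribed cluster sets\<close>

lemma incr_homeo_interp:
  assumes c: "\<And>n. incr_homeo (c n)" and x: "0 \<le> x"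
  shows "incr_homeo (\<lambda>r. interp (\<lambda>n. c n r) x)"
  unfolding incr_homeo_def
proof (intro conjI)
  show "continuous_on J (\<lambda>r. interp (\<lambda>n. c n r) x)"
    using c by (intro continuous_on_interp continuous_intros) (auto simp: incr_homeo_def)
  show "strict_mono_on J (\<lambda>r. interp (\<lambda>n. c n r) x)"
    using c by (intro strict_mono_onI interp_strict_mono x) (auto simp: incr_homeo_def strict_mono_on_def)
  show "interp (\<lambda>n. c n (-1)) x = -1" "interp (\<lambda>n. c n 1) x = 1"
    using c x by (simp_all add: incr_homeo_def interp_const)
qed

text \<open>The index of the set containing a point is continuous on a finite union of disjoint
  closed sets, and Dugundji's theorem extends it to the whole space with values in
  \<open>{0..}\<close>. Used as the argument of \<open>interp\<close>, it picks the
  \<open>n\<close>-th target on \<open>K n\<close> and blends targets elsewhere.\<close>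

lemma exists_selector:
  fixes K :: "nat \<Rightarrow> 'a::{metric_space,second_countable_topology} set"
  assumes "\<And>n. closed (K n)" "disjoint_family K"
  shows "\<exists>\<phi>. continuous_on UNIV \<phi> \<and> (\<forall>z. 0 \<le> \<phi> z) \<and> (\<forall>n\<le>m. \<forall>z\<in>K n. \<phi> z = real n)"
proof -
  define S where "S = (\<Union>n\<in>{..m}. K n)"
  define f where "f = (\<lambda>z. real (THE n. z \<in> K n))"
  have f: "f z = real n" if "z \<in> K n" for z n
  proof -
    have "(THE n. z \<in> K n) = n"
      using that assms(2) by (intro the_equality) (auto simp: disjoint_family_on_def)
    then show ?thesis by (simp add: f_def)
  qed
  have "continuous_on S f"
    unfolding S_def
  proof (rule continuous_on_closed_Union)
    show "continuous_on (K n) f" for n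
      using continuous_on_cong[THEN iffD2, OF refl f continuous_on_const] .
  qed (use assms in auto)
  moreover have "closed S"
    unfolding S_def using assms(1) by (intro closed_UN) auto
  then have "closedin (top_of_set UNIV) S"
    by simp
  moreover have "f ` S \<subseteq> {0..}"
    by (auto simp: f_def)
  ultimately obtain \<phi> where \<phi>: "continuous_on UNIV \<phi>" "\<phi> ` UNIV \<subseteq> {0..}" "\<And>z. z \<in> S \<Longrightarrow> \<phi> z = f z"
    using Dugundji[OF convex_real_interval(1)[of 0]] by (metis atLeast_iff empty_iff order_refl)
  moreover have "\<phi> z = real n" if "n \<le> m" "z \<in> K n" for n z
    using \<phi>(3)[of z] f[OF that(2)] that by (auto simp: S_def)
  moreover have "0 \<le> \<phi> z" for z
    using \<phi>(2) by auto
  ultimately show ?thesis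
    by blast
qed

text \<open>Unit time will be one application of the model map, so the bound \<open>2 / t\<close>
  makes the conjugated map continuous at the horizontal edges. Being the identity up to time 1 lets
  two such isotopies be glued along level 0.\<close>

definition slow_isotopy :: "(real \<Rightarrow> real \<Rightarrow> real) \<Rightarrow> bool" where
  "slow_isotopy G \<longleftrightarrow> continuous_on (UNIV \<times> J) (\<lambda>(t, r). G t r) \<and> (\<forall>t. incr_homeo (G t)) \<and>
    (\<forall>t\<le>1. \<forall>r. G t r = r) \<and> (\<forall>t\<ge>1. \<forall>r\<in>J. \<bar>G (t + 1) r - G t r\<bar> \<le> 2 / t)"

lemma slow_isotopyD:
  assumes "slow_isotopy G"
  shows "continuous_on (UNIV \<times> J) (\<lambda>(t, r). G t r)" "incr_homeo (G t)"
    "t \<le> 1 \<Longrightarrow> G t r = r" "1 \<le> t \<Longrightarrow> r \<in> J \<Longrightarrow> \<bar>G (t + 1) r - G t r\<bar> \<le> 2 / t"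
  using assms by (auto simp: slow_isotopy_def)

text \<open>Continuous time \<open>t\<close> makes the orbit of a level in the fundamental domain the sequence
  \<open>t, t + 1, t + 2, \<dots>\<close>. The circle \<open>cis (2 \<pi> t)\<close> identifies the two ends of the
  fundamental domain, so the target at stage \<open>m\<close> depends on the orbit only. The logarithm slows
  the passage from stage to stage down.\<close>

lemma isotopy_on_circle:
  fixes Z :: "nat \<Rightarrow> complex set" and K :: "nat \<Rightarrow> nat \<Rightarrow> complex set"
  assumes K: "\<And>n m. closed (K n m)" "\<And>n. incseq (K n)" "\<And>n. (\<Union>m. K n m) = Z n"
    and Z: "disjoint_family Z"
    and a: "\<And>n. mono_on J (a n)" "\<And>n. a n (-1) = -1" "\<And>n. a n 1 = 1"
    and b: "\<And>n. mono_on J (b n)" "\<And>n. b n (-1) = -1" "\<And>n. b n 1 = 1"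
    and ab: "\<And>n r. r \<in> J \<Longrightarrow> a n r \<le> b n r"
  shows "\<exists>G. slow_isotopy G \<and> (\<forall>n t. cis (2 * pi * t) \<in> Z n \<longrightarrow>
    (\<forall>r\<in>J. cluster_set (\<lambda>k. G (t + real k) r) = {a n r..b n r}))"
proof -
  obtain ga where ga: "\<And>n m. incr_homeo (ga n m)" "\<And>n r. r \<in> J \<Longrightarrow> (\<lambda>m. ga n m r) \<longlonglongrightarrow> a n r"
    using mono_on_seq_approx[OF a] by metis
  obtain gb where gb: "\<And>n m. incr_homeo (gb n m)" "\<And>n r. r \<in> J \<Longrightarrow> (\<lambda>m. gb n m r) \<longlonglongrightarrow> b n r"
    using mono_on_seq_approx[OF b] by metis
  \<comment> \<open>Even stages approximate \<open>a n\<close>, odd stages \<open>b n\<close>. Stage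
    0 is the identity for every \<open>n\<close>, so that the isotopy can start there whatever the
    selector does.\<close>
  define c where "c = (\<lambda>n m r. if m = 0 then r else if even m then ga n (m div 2) r else gb n (m div 2) r)"
  have c: "incr_homeo (c n m)" for n m
    using ga(1) gb(1) by (cases "m = 0"; cases "even m") (auto simp: c_def incr_homeo_id)
  have c_even: "(\<lambda>j. c n (2 * j) r) \<longlonglongrightarrow> a n r" and c_odd: "(\<lambda>j. c n (Suc (2 * j)) r) \<longlonglongrightarrow> b n r"
    if "r \<in> J" for n r
  proof -
    have "\<forall>\<^sub>F j in sequentially. ga n j r = c n (2 * j) r"
      using eventually_gt_at_top[of 0] by eventually_elim (simp add: c_def)
    with ga(2)[OF that] show "(\<lambda>j. c n (2 * j) r) \<longlonglongrightarrow> a n r"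
      by (rule Lim_transform_eventually)
    show "(\<lambda>j. c n (Suc (2 * j)) r) \<longlonglongrightarrow> b n r"
      using gb(2)[OF that] by (simp add: c_def)
  qed
  have KZ: "K n m \<subseteq> Z n" for n m
    using K(3) by auto
  have "disjoint_family (\<lambda>n. K n m)" for m
    using Z KZ unfolding disjoint_family_on_def by blast
  then have "\<exists>\<phi>. continuous_on UNIV \<phi> \<and> (\<forall>z. 0 \<le> \<phi> z) \<and> (\<forall>n\<le>m. \<forall>z\<in>K n m. \<phi> z = real n)" for m
    using exists_selector[of "\<lambda>n. K n m" m] K(1) by blast
  then obtain \<phi> where \<phi>: "\<And>m. continuous_on UNIV (\<phi> m)" "\<And>m z. 0 \<le> \<phi> m z"
      "\<And>m n z. n \<le> m \<Longrightarrow> z \<in> K n m \<Longrightarrow> \<phi> m z = real n"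
    by metis
  define C where "C = (\<lambda>m z r. interp (\<lambda>n. c n m r) (\<phi> m z))"
  have C: "incr_homeo (C m z)" for m z
    unfolding C_def by (rule incr_homeo_interp[OF c \<phi>(2)])
  have C0: "C 0 z r = r" for z r
    unfolding C_def using \<phi>(2) by (simp add: c_def interp_const)
  \<comment> \<open>Here 2 is the length of \<open>J\<close>; with the bound \<open>1 / t\<close> on
    the steps of \<sigma> it yields the rate \<open>2 / t\<close>.\<close>
  have C_step: "\<bar>C (Suc m) z r - C m z r\<bar> \<le> 2" if "r \<in> J" for m z r
    using incr_homeo_mem[OF C that, of m z] incr_homeo_mem[OF C that, of "Suc m" z] by (auto simp: J_def)
  \<comment> \<open>Clamping at 1 keeps \<sigma> at 0 up to time 1, where \<open>G\<close> is
    therefore the identity stage.\<close>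
  define \<sigma> where "\<sigma> = (\<lambda>t::real. ln (max 1 t))"
  have \<sigma>0: "0 \<le> \<sigma> t" for t
    by (simp add: \<sigma>_def)
  have \<sigma>_step: "\<bar>\<sigma> (t + 1) - \<sigma> t\<bar> \<le> 1 / t" if "t \<ge> 1" for t
  proof -
    have "\<sigma> (t + 1) - \<sigma> t = ln (1 + 1 / t)"
      using that ln_div[of "t + 1" t] by (simp add: \<sigma>_def add_divide_distrib)
    moreover have "ln (1 + 1 / t) \<le> 1 / t" "0 \<le> ln (1 + 1 / t)"
      using that by (auto intro!: ln_add_one_self_le_self)
    ultimately show ?thesis by simp
  qed
  define G where "G = (\<lambda>t r. interp (\<lambda>m. C m (cis (2 * pi * t)) r) (\<sigma> t))"
  have "continuous_on (UNIV \<times> J) (\<lambda>(t, r). G t r)"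
    unfolding G_def C_def case_prod_beta
  proof (intro continuous_on_interp)
    show "continuous_on (UNIV \<times> J) (\<lambda>p. c n m (snd p))" for n m
      by (rule continuous_on_compose2[of J "c n m"]) (use c in \<open>auto simp: incr_homeo_def intro: continuous_intros\<close>)
    show "continuous_on (UNIV \<times> J) (\<lambda>p. \<phi> m (cis (2 * pi * fst p)))" for m
      by (rule continuous_on_compose2[OF \<phi>(1)]) (auto intro!: continuous_intros)
    show "continuous_on (UNIV \<times> J) (\<lambda>p. \<sigma> (fst p))"
      unfolding \<sigma>_def by (auto intro!: continuous_intros)
  qed
  moreover have "incr_homeo (G t)" for t
    unfolding G_def by (rule incr_homeo_interp[OF C \<sigma>0])
  moreover have "G t r = r" if "t \<le> 1" for t r
    using that interp_nat[of _ 0] by (simp add: G_def \<sigma>_def C0)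
  moreover have "\<bar>G (t + 1) r - G t r\<bar> \<le> 2 / t" if "t \<ge> 1" "r \<in> J" for t r
  proof -
    \<comment> \<open>The stages depend on \<open>t\<close> only modulo 1, so over unit time nothing
      but \<sigma> changes.\<close>
    have per: "cis (2 * pi * (t + 1)) = cis (2 * pi * t)"
      by (simp add: distrib_left flip: cis_mult)
    have "\<bar>G (t + 1) r - G t r\<bar> \<le> 2 * \<bar>\<sigma> (t + 1) - \<sigma> t\<bar>"
      unfolding G_def per 
      by (rule interp_Lipschitz[where c = "\<lambda>m. C m (cis (2 * pi * t)) r", OF \<sigma>0 \<sigma>0 C_step[OF that(2)]])
    then show ?thesis
      using \<sigma>_step[OF that(1)] by simp
  qed
  moreover have "cluster_set (\<lambda>k. G (t + real k) r) = {a n r..b n r}"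
    if t: "cis (2 * pi * t) \<in> Z n" and r: "r \<in> J" for n t r
  proof -
    define z where "z = cis (2 * pi * t)"
    have per: "cis (2 * pi * (t + real k)) = z" for k
      by (simp add: z_def distrib_left cis_multiple_2pi flip: cis_mult)
    obtain M where "z \<in> K n M"
      using t K(3) by (auto simp: z_def)
    then have "z \<in> K n m" if "m \<ge> M" for m
      using K(2) that by (auto simp: incseq_def)
    \<comment> \<open>\<open>M\<close> puts \<open>z\<close> into the compact pieces of
      \<open>Z n\<close>, and \<open>n \<le> m\<close> puts \<open>n\<close> among the targets that
      stage \<open>m\<close> selects exactly.\<close>
    then have Cc: "C m z r = c n m r" if "m \<ge> max M n" for m
      using \<phi>(3)[of n m z] that by (simp add: C_def)
    have ev: "\<forall>\<^sub>F j in sequentially. c n (q j) r = C (q j) z r" if "\<And>j. j \<le> q j" for q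
      using eventually_ge_at_top[of "max M n"] by eventually_elim (metis Cc order_trans that)
    have lim: "(\<lambda>j. C (2 * j) z r) \<longlonglongrightarrow> a n r" "(\<lambda>j. C (Suc (2 * j)) z r) \<longlonglongrightarrow> b n r"
      using Lim_transform_eventually[OF c_even[OF r] ev] Lim_transform_eventually[OF c_odd[OF r] ev]
      by simp_all
    have top: "filterlim (\<lambda>k. t + real k) at_top sequentially"
      by (rule filterlim_tendsto_add_at_top[OF tendsto_const filterlim_real_sequentially])
    have "cluster_set (\<lambda>k. interp (\<lambda>m. C m z r) (\<sigma> (t + real k))) = {a n r..b n r}"
    proof (rule interp_cluster[where e = "\<lambda>m. C m z r", OF C_step[OF r] lim ab[OF r] \<sigma>0])
      have "filterlim (\<lambda>x::real. ln (max 1 x)) at_top at_top"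
        by (rule filterlim_mono_eventually[OF ln_at_top order_refl order_refl])
          (use eventually_ge_at_top[of 1] in eventually_elim, auto)
      then show "filterlim (\<lambda>k. \<sigma> (t + real k)) at_top sequentially"
        unfolding \<sigma>_def using top by (rule filterlim_compose)
      show "(\<lambda>k. \<sigma> (t + real (Suc k)) - \<sigma> (t + real k)) \<longlonglongrightarrow> 0"
      proof (rule Lim_null_comparison)
        have "\<forall>\<^sub>F k in sequentially. 1 \<le> t + real k"
          using top unfolding filterlim_at_top by blast
        then show "\<forall>\<^sub>F k in sequentially. norm (\<sigma> (t + real (Suc k)) - \<sigma> (t + real k)) \<le> 1 / (t + real k)"
        proof eventually_elim
          case (elim k)
          have "t + real (Suc k) = (t + real k) + 1" by simp
          then show ?case using \<sigma>_step[OF elim] by (metis real_norm_def)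
        qed
        show "(\<lambda>k. 1 / (t + real k)) \<longlonglongrightarrow> 0"
          by (rule tendsto_divide_0[OF tendsto_const filterlim_at_top_imp_at_infinity[OF top]])
      qed
    qed
    then show ?thesis
      by (simp add: G_def per)
  qed
  ultimately show ?thesis
    unfolding slow_isotopy_def by blast
qed

section \<open>From families of levels and continua to families on the circle\<close>

text \<open>A bounded connected set of reals is an interval: keep an endpoint that belongs to it and
  approach a missing one by \<open>1 / (m + 1)\<close>. Early members may be empty. The selectors
  work on closed sets, whereas the given intervals may be half-open or open.\<close>

lemma connected_exhaustion:
  fixes V :: "real set"
  assumes V: "connected V" and bdd: "bounded V"
  shows "\<exists>C. (\<forall>m::nat. compact (C m)) \<and> incseq C \<and> (\<Union>m. C m) = V"
proof (cases "V = {}")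
  case True
  then show ?thesis
    by (intro exI[of _ "\<lambda>m. {}"]) auto
next
  case False
  have bb: "bdd_below V" "bdd_above V"
    using bdd by (simp_all add: bounded_imp_bdd_below bounded_imp_bdd_above)
  define l where "l = Inf V"
  define u where "u = Sup V"
  define t where "t = (\<lambda>m. inverse (real (Suc m)))"
  have t0: "t m > 0" for m
    by (simp add: t_def)
  have t_mono: "t n \<le> t m" if "m \<le> n" for m n
    using that by (simp add: t_def field_simps)
  have t_small: "\<exists>M. \<forall>m\<ge>M. t m < e" if "e > 0" for e
    using order_tendstoD(2)[OF LIMSEQ_inverse_real_of_nat that] by (simp add: t_def eventually_sequentially)
  define p where "p = (\<lambda>m. if l \<in> V then l else l + t m)"
  define q where "q = (\<lambda>m. if u \<in> V then u else u - t m)"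
  define C where "C = (\<lambda>m. {p m..q m})"
  have "C m \<subseteq> V" for m
  proof
    fix x assume x: "x \<in> C m"
    have "\<exists>v\<in>V. v \<le> x"
    proof (cases "l \<in> V")
      case False
      obtain v where "v \<in> V" "v < l + t m"
        using cInf_lessD[OF \<open>V \<noteq> {}\<close>, of "l + t m"] t0[of m] by (auto simp: l_def)
      then show ?thesis
        using x False by (intro bexI[of _ v]) (auto simp: C_def p_def)
    qed (use x in \<open>auto simp: C_def p_def\<close>)
    moreover have "\<exists>v\<in>V. x \<le> v"
    proof (cases "u \<in> V")
      case False
      obtain v where "v \<in> V" "u - t m < v"
        using less_cSupD[OF \<open>V \<noteq> {}\<close>, of "u - t m"] t0[of m] by (auto simp: u_def)
      then show ?thesis
        using x False by (intro bexI[of _ v]) (auto simp: C_def q_def)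
    qed (use x in \<open>auto simp: C_def q_def\<close>)
    ultimately show "x \<in> V"
      using connectedD_interval[OF V] by blast
  qed
  moreover have "\<exists>m. x \<in> C m" if x: "x \<in> V" for x
  proof -
    have lx: "l \<le> x" "x \<le> u"
      using bb x by (auto simp: l_def u_def cInf_lower cSup_upper)
    have "\<exists>M. \<forall>m\<ge>M. p m \<le> x"
    proof (cases "l \<in> V")
      case False
      then have "l < x" using lx x by (auto simp: order.order_iff_strict)
      then obtain M where "\<forall>m\<ge>M. t m < x - l" using t_small[of "x - l"] by auto
      then show ?thesis using False by (intro exI[of _ M]) (force simp: p_def)
    qed (use lx in \<open>auto simp: p_def\<close>)
    moreover have "\<exists>M. \<forall>m\<ge>M. x \<le> q m"
    proof (cases "u \<in> V")
      case False
      then have "x < u" using lx x by (auto simp: order.order_iff_strict)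
      then obtain M where "\<forall>m\<ge>M. t m < u - x" using t_small[of "u - x"] by auto
      then show ?thesis using False by (intro exI[of _ M]) (force simp: q_def)
    qed (use lx in \<open>auto simp: q_def\<close>)
    ultimately show ?thesis
      unfolding C_def by (metis atLeastAtMost_iff max.cobounded1 max.cobounded2)
  qed
  moreover have "C m \<subseteq> C n" if "m \<le> n" for m n
    using t_mono[OF that] by (auto simp: C_def p_def q_def)
  ultimately show ?thesis
    by (intro exI[of _ C]) (auto simp: incseq_def C_def)
qed

text \<open>The abscissas form a compact connected set, hence a closed interval. A map into
  \<open>level_continua c\<close> is thereby encoded by two real functions.\<close>

lemma level_continuaE:
  assumes "A \<in> level_continua c"
  shows "A = {Inf (fst ` A)..Sup (fst ` A)} \<times> {c}" "Inf (fst ` A) \<le> Sup (fst ` A)"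
proof -
  define B where "B = fst ` A"
  have A: "A \<noteq> {}" "connected A" "closed A" "A \<subseteq> J \<times> {c}"
    using assms by (auto simp: level_continua_def level_def)
  have AB: "A = B \<times> {c}"
    using A(4) by (force simp: B_def)
  have "compact (J \<times> {c})"
    by (auto simp: J_def intro: compact_Times)
  then have "compact A"
    using A by (metis Int_absorb2 compact_Int_closed inf_commute)
  then have "compact B" "connected B" "B \<noteq> {}"
    unfolding B_def using A by (auto intro!: compact_continuous_image connected_continuous_image continuous_intros)
  then obtain a b where B: "B = {a..b}" "a \<le> b"
    using connected_compact_interval_1[of B] by (auto simp: box_real)
  then have "Inf B = a" "Sup B = b"
    by auto
  with AB B show "A = {Inf (fst ` A)..Sup (fst ` A)} \<times> {c}" "Inf (fst ` A) \<le> Sup (fst ` A)"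
    by (simp_all flip: B_def)
qed

lemma cis_2pi_eq_iff: "cis (2 * pi * x) = cis (2 * pi * y) \<longleftrightarrow> (\<exists>n::int. x = y + of_int n)"
proof -
  have "cis (2 * pi * x) = cis (2 * pi * y) \<longleftrightarrow> (\<exists>n::int. 2 * pi * x = 2 * pi * y + 2 * pi * of_int n)"
    by (subst sin_cos_eq_iff[symmetric]) (auto simp: complex_eq_iff)
  also have "\<dots> \<longleftrightarrow> (\<exists>n::int. x = y + of_int n)"
    by (simp flip: distrib_left)
  finally show ?thesis .
qed

text \<open>Here \<open>h\<close> is the time of a level. Injectivity of its image on the circle
  means that times of distinct levels in \<open>S\<close> never differ by an integer, so the
  disjoint \<open>V n\<close> stay disjoint on the circle.\<close>

lemma isotopy_with_limits:
  fixes N :: "nat set" and V :: "nat \<Rightarrow> real set" and h :: "real \<Rightarrow> real"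
    and \<phi> :: "nat \<Rightarrow> real \<Rightarrow> (real \<times> real) set"
  assumes disj: "disjoint_family_on V N"
    and V: "\<And>n. n \<in> N \<Longrightarrow> connected (V n) \<and> V n \<subseteq> S" and S: "bounded S"
    and h: "continuous_on S h" "inj_on (\<lambda>s. cis (2 * pi * h s)) S"
    and \<phi>: "\<And>n. n \<in> N \<Longrightarrow>
      \<phi> n \<in> J \<rightarrow> level_continua c \<and> increasing_map (\<phi> n) \<and> endpoint_preserving c (\<phi> n)"
  shows "\<exists>G. slow_isotopy G \<and>
    (\<forall>n\<in>N. \<forall>s\<in>V n. \<forall>r\<in>J. cluster_set (\<lambda>k. G (h s + real k) r) \<times> {c} = \<phi> n r)"
proof -
  define e where "e = (\<lambda>s. cis (2 * pi * h s))"
  have e: "continuous_on S e"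
    unfolding e_def by (intro continuous_intros h(1))
  have "\<exists>C. (\<forall>m::nat. compact (C m)) \<and> incseq C \<and> (\<Union>m. C m) = V n" if "n \<in> N" for n
    using connected_exhaustion[of "V n"] V[OF that] bounded_subset[OF S] by blast
  then obtain C where C: "\<And>n m. n \<in> N \<Longrightarrow> compact (C n m)" "\<And>n. n \<in> N \<Longrightarrow> incseq (C n)"
      "\<And>n. n \<in> N \<Longrightarrow> (\<Union>m. C n m) = V n"
    by metis
  \<comment> \<open>Indices outside \<open>N\<close> get empty sets and identity targets, which
    makes the families total as \<open>isotopy_on_circle\<close> expects.\<close>
  define K where "K = (\<lambda>n m. if n \<in> N then e ` C n m else {})"
  define Z where "Z = (\<lambda>n. if n \<in> N then e ` V n else {})"
  define a where "a = (\<lambda>n r. if n \<in> N then Inf (fst ` \<phi> n r) else r)"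
  define b where "b = (\<lambda>n r. if n \<in> N then Sup (fst ` \<phi> n r) else r)"
  have CS: "C n m \<subseteq> S" if "n \<in> N" for n m
    using C(3)[OF that] V[OF that] by blast
  have "\<exists>G. slow_isotopy G \<and> (\<forall>n t. cis (2 * pi * t) \<in> Z n \<longrightarrow>
    (\<forall>r\<in>J. cluster_set (\<lambda>k. G (t + real k) r) = {a n r..b n r}))"
  proof (rule isotopy_on_circle[where K = K])
    show "closed (K n m)" for n m
      using C(1)[of n] CS[of n m] by (auto simp: K_def intro!: compact_imp_closed compact_continuous_image continuous_on_subset[OF e])
    show "incseq (K n)" for n
      using C(2)[of n] by (auto simp: K_def incseq_def intro!: image_mono)
    show "(\<Union>m. K n m) = Z n" for n
      using C(3)[of n] by (auto simp: K_def Z_def)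
    show "disjoint_family Z"
      unfolding disjoint_family_on_def
    proof (intro ballI impI)
      fix m n :: nat assume mn: "m \<noteq> n"
      show "Z m \<inter> Z n = {}"
      proof (cases "m \<in> N \<and> n \<in> N")
        case True
        then have "e ` V m \<inter> e ` V n = e ` (V m \<inter> V n)"
          using V h(2) unfolding e_def by (intro inj_on_image_Int[symmetric]) auto
        then show ?thesis
          using disj True mn by (simp add: Z_def disjoint_family_on_def)
      qed (auto simp: Z_def)
    qed
    have mono: "Inf (fst ` \<phi> n r1) \<le> Inf (fst ` \<phi> n r2) \<and> Sup (fst ` \<phi> n r1) \<le> Sup (fst ` \<phi> n r2)"
      if "n \<in> N" "r1 \<in> J" "r2 \<in> J" "r1 \<le> r2" for n r1 r2
      using \<phi>[OF that(1)] that by (cases "r1 = r2") (auto simp: increasing_map_def)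
    show "mono_on J (a n)" "mono_on J (b n)" for n
      using mono by (auto simp: a_def b_def mono_on_def)
    show "a n (-1) = -1" "a n 1 = 1" "b n (-1) = -1" "b n 1 = 1" for n
      using \<phi> by (auto simp: a_def b_def endpoint_preserving_def)
    show "a n r \<le> b n r" if "r \<in> J" for n r
      using \<phi>[of n] level_continuaE(2) that by (auto simp: a_def b_def)
  qed
  then obtain G where G: "slow_isotopy G" "\<And>n t r. cis (2 * pi * t) \<in> Z n \<Longrightarrow> r \<in> J \<Longrightarrow>
      cluster_set (\<lambda>k. G (t + real k) r) = {a n r..b n r}"
    by blast
  have "cluster_set (\<lambda>k. G (h s + real k) r) \<times> {c} = \<phi> n r"
    if "n \<in> N" "s \<in> V n" "r \<in> J" for n s r
  proof -
    have "cis (2 * pi * h s) \<in> Z n"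
      using that by (auto simp: Z_def e_def)
    then have "cluster_set (\<lambda>k. G (h s + real k) r) = {a n r..b n r}"
      by (rule G(2)) (rule that(3))
    moreover have "\<phi> n r = {a n r..b n r} \<times> {c}"
      using \<phi>[OF that(1)] level_continuaE(1)[of "\<phi> n r" c] that by (auto simp: a_def b_def)
    ultimately show ?thesis by simp
  qed
  with G(1) show ?thesis
    by blast
qed

subsection \<open>Conjugates of the model map\<close>

text \<open>The three pieces form a concave function, the minimum of its affine pieces; continuity
  is then immediate.\<close>

lemma f01_min: "f01 s = min ((s + 1) / 2) (min (s + 1 / 2) (2 * s + 1))"
  by (auto simp: f01_def min_def field_simps)

lemma continuous_on_f01: "continuous_on S f01"
  unfolding f01_min[abs_def] by (intro continuous_intros) auto

lemma f01_minus_f01 [simp]: "f01 (- f01 (- s)) = s"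
  by (auto simp: f01_def field_simps)

lemma minus_f01_f01 [simp]: "- f01 (- f01 s) = s"
  using f01_minus_f01[of "- s"] by (metis minus_minus)

lemma f01_strict: "f01 s < 1 \<longleftrightarrow> s < 1" "-1 < f01 s \<longleftrightarrow> -1 < s"
  by (auto simp: f01_def field_simps)

lemma f01_eq_iff [simp]: "f01 s = f01 t \<longleftrightarrow> s = t"
  by (metis minus_f01_f01)

lemma f01_J [simp]: "f01 s \<in> J \<longleftrightarrow> s \<in> J"
  by (auto simp: f01_def J_def)

lemma f01_nonneg: "0 \<le> s \<Longrightarrow> f01 s = (s + 1) / 2"
  by (simp add: f01_def)

lemma f01_ge_0: "0 \<le> s \<Longrightarrow> 0 \<le> f01 s"
  by (simp add: f01_nonneg)

lemma f02_level: "f02 ` level s = level (f01 s)"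
  by (force simp: f02_def level_def)

lemma frontier_J2: "frontier J2 \<subseteq> {p \<in> J2. \<bar>fst p\<bar> = 1 \<or> \<bar>snd p\<bar> = 1}"
proof -
  have "closed J2"
    unfolding J2_def J_def by (intro closed_Times) auto
  moreover have "interior J2 = {-1<..<1} \<times> {-1<..<1}"
    by (simp add: J2_def J_def interior_Times)
  ultimately have fr: "frontier J2 = J2 - {-1<..<1} \<times> {-1<..<1}"
    by (simp add: frontier_def)
  show ?thesis
  proof
    fix p assume "p \<in> frontier J2"
    then have p: "p \<in> J2" "\<not> (-1 < fst p \<and> fst p < 1) \<or> \<not> (-1 < snd p \<and> snd p < 1)"
      unfolding fr by (auto simp: mem_Times_iff)
    then have "fst p \<in> {-1..1}" "snd p \<in> {-1..1}"
      unfolding J2_def J_def by (auto simp: mem_Times_iff)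
    then have "\<bar>fst p\<bar> = 1 \<or> \<bar>snd p\<bar> = 1"
      using p(2) by force
    then show "p \<in> {p \<in> J2. \<bar>fst p\<bar> = 1 \<or> \<bar>snd p\<bar> = 1}"
      using p(1) by simp
  qed
qed

text \<open>On a compact strip \<open>{-c..c} \<times> J\<close> the fibred map \<Phi> is a
  continuous bijection, so its inverse is continuous. Every point has such a strip as a relative
  neighbourhood.\<close>

lemma continuous_on_fibre_inverse:
  fixes Q :: "real \<Rightarrow> real \<Rightarrow> real"
  assumes cont: "continuous_on ({-1<..<1} \<times> J) (\<lambda>(s, r). Q s r)"
    and Q: "\<And>s. s \<in> {-1<..<1} \<Longrightarrow> incr_homeo (Q s)"
  shows "continuous_on ({-1<..<1} \<times> J) (\<lambda>(s, r). inv_into J (Q s) r)"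
  unfolding continuous_on_eq_continuous_within
proof
  define P where "P = (\<lambda>(s, r). inv_into J (Q s) r)"
  fix p :: "real \<times> real" assume p: "p \<in> {-1<..<1} \<times> J"
  then obtain c where c: "\<bar>fst p\<bar> < c" "c < 1"
    using dense[of "\<bar>fst p\<bar>" 1] by (auto simp: abs_less_iff)
  have sub: "{-c..c} \<subseteq> {-1<..<1}"
    using c by auto
  define \<Phi> where "\<Phi> = (\<lambda>(s, r). (s, Q s r))"
  have "continuous_on ({-c..c} \<times> J) \<Phi>"
    unfolding \<Phi>_def case_prod_beta
    by (intro continuous_intros continuous_on_subset[OF cont[unfolded case_prod_beta]]) (use sub in auto)
  moreover have "compact ({-c..c} \<times> J)"
    by (auto simp: J_def intro: compact_Times)
  moreover have "\<forall>x\<in>{-c..c} \<times> J. (\<lambda>p. (fst p, P p)) (\<Phi> x) = x"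
  proof
    fix x assume "x \<in> {-c..c} \<times> J"
    then obtain s r where x: "x = (s, r)" "s \<in> {-c..c}" "r \<in> J"
      by auto
    then have "inj_on (Q s) J"
      using incr_homeo_inj Q sub by blast
    then show "(\<lambda>p. (fst p, P p)) (\<Phi> x) = x"
      using x by (simp add: \<Phi>_def P_def)
  qed
  ultimately have "continuous_on (\<Phi> ` ({-c..c} \<times> J)) (\<lambda>p. (fst p, P p))"
    by (rule continuous_on_inv)
  moreover have "\<Phi> ` ({-c..c} \<times> J) = {-c..c} \<times> J"
  proof -
    have "Q s ` J = J" if "s \<in> {-c..c}" for s
      using incr_homeo_image Q sub that by blast
    then show ?thesis
      by (auto simp: \<Phi>_def image_iff) (metis (no_types, lifting) atLeastAtMost_iff image_iff)+
  qed
  ultimately have "continuous_on ({-c..c} \<times> J) P"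
    using continuous_on_snd by fastforce
  then have "continuous (at p within {-c..c} \<times> J) P"
    using p c by (auto simp: continuous_on_eq_continuous_within abs_less_iff)
  moreover have "at p within {-c..c} \<times> J = at p within {-1<..<1} \<times> J"
    by (rule at_within_nhd[of _ "{-c<..<c} \<times> UNIV"]) (use p c in \<open>auto intro: open_Times\<close>)
  ultimately show "continuous (at p within {-1<..<1} \<times> J) P"
    by simp
qed

text \<open>On the open strip \<open>f\<close> is the conjugate of \<open>f02\<close> by
  \<open>(r, s) \<mapsto> (Q s r, s)\<close>, on the horizontal edges it is \<open>f02\<close>.
  Continuity at these edges holds because, with \<open>r' = P s r\<close>, the displacement
  \<open>h s r - r\<close> equals \<open>Q (f01 s) r' - Q s r'\<close>, which \<open>lim\<close>
  makes small uniformly in \<open>r'\<close>.\<close>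

lemma normally_rising_conjugate:
  fixes Q :: "real \<Rightarrow> real \<Rightarrow> real"
  assumes cont: "continuous_on ({-1<..<1} \<times> J) (\<lambda>(s, r). Q s r)"
    and Q: "\<And>s. s \<in> {-1<..<1} \<Longrightarrow> incr_homeo (Q s)"
    and lim: "\<And>\<epsilon>. \<epsilon> > 0 \<Longrightarrow>
      \<exists>\<delta>>0. \<forall>s\<in>{-1<..<1}. 1 - \<delta> < \<bar>s\<bar> \<longrightarrow> (\<forall>r\<in>J. \<bar>Q (f01 s) r - Q s r\<bar> < \<epsilon>)"
  shows "\<exists>f. normally_rising f \<and>
    (\<forall>s\<in>{-1<..<1}. \<forall>r\<in>J. f (Q s r, s) = (Q (f01 s) r, f01 s))"
proof -
  define P where "P = (\<lambda>s. inv_into J (Q s))"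
  have P: "P s r \<in> J" "Q s (P s r) = r" if "s \<in> {-1<..<1}" "r \<in> J" for s r
    using incr_homeo_image[OF Q[OF that(1)]] that(2)
    by (auto simp: P_def inv_into_into f_inv_into_f)
  have PQ: "P s (Q s r) = r" if "s \<in> {-1<..<1}" "r \<in> J" for s r
    using incr_homeo_inj[OF Q[OF that(1)]] that(2) by (simp add: P_def)
  have f01_open: "f01 s \<in> {-1<..<1}" if "s \<in> {-1<..<1}" for s
    using that by (simp add: f01_strict)
  define h where "h = (\<lambda>s r. if \<bar>s\<bar> < 1 then Q (f01 s) (P s r) else r)"
  define f where "f = (\<lambda>(r, s). (h s r, f01 s))"
  have h: "incr_homeo (h s)" for s
  proof (cases "\<bar>s\<bar> < 1")
    case True
    then have s: "s \<in> {-1<..<1}" by auto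
    have "P s r < P s r'" if rr: "r \<in> J" "r' \<in> J" "r < r'" for r r'
    proof (rule ccontr)
      assume "\<not> P s r < P s r'"
      then have "Q s (P s r') \<le> Q s (P s r)"
        using Q[OF s] P(1)[OF s] rr strict_mono_on_imp_mono_on[of J "Q s"]
        by (auto simp: incr_homeo_def mono_on_def)
      then show False
        using P(2)[OF s] rr by simp
    qed
    then have "strict_mono_on J (h s)"
      using True Q[OF f01_open[OF s]] P(1)[OF s]
      by (auto simp: h_def incr_homeo_def strict_mono_on_def)
    moreover have "h s (-1) = -1" "h s 1 = 1"
      using PQ[OF s, of "-1"] PQ[OF s, of 1] Q[OF s] Q[OF f01_open[OF s]] True
      by (simp_all add: h_def incr_homeo_def J_def)
    moreover have "continuous_on J (P s)"
    proof -
      have "continuous_on J (\<lambda>r. (\<lambda>(s, r). inv_into J (Q s) r) (s, r))"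
        by (rule continuous_on_compose2[OF continuous_on_fibre_inverse[OF cont Q]])
          (use s in \<open>auto intro!: continuous_intros\<close>)
      then show ?thesis by (simp add: P_def)
    qed
    then have "continuous_on J (h s)"
      using True P(1)[OF s] Q[OF f01_open[OF s]]
      by (auto simp: h_def incr_homeo_def intro: continuous_on_compose2)
    ultimately show ?thesis
      by (simp add: incr_homeo_def)
  next
    case False
    then show ?thesis
      by (simp add: h_def[abs_def] incr_homeo_id)
  qed
  have f_level: "f ` level s = level (f01 s)" for s
    using incr_homeo_image[OF h[of s]] by (force simp: f_def level_def)
  have J2_level: "J2 = (\<Union>s\<in>J. level s)"
    by (auto simp: J2_def level_def)
  have "f ` J2 = J2"
  proof -
    have "f ` J2 = (\<Union>s\<in>J. level (f01 s))"
      by (simp add: J2_level image_UN f_level)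
    moreover have "f01 ` J = J"
      by (auto simp: image_iff) (metis f01_J f01_minus_f01)
    ultimately show ?thesis
      by (metis (no_types, lifting) J2_level SUP_cong UN_extend_simps(10))
  qed
  moreover have "inj_on f J2"
    using incr_homeo_inj[OF h] by (auto simp: inj_on_def f_def J2_def)
  moreover have "continuous_on J2 (\<lambda>(r, s). h s r - r)"
    unfolding continuous_on_eq_continuous_within
  proof
    define E where "E = (\<lambda>(r, s). h s r - r)"
    fix p assume p: "p \<in> J2"
    show "continuous (at p within J2) E"
    proof (cases "\<bar>snd p\<bar> < 1")
      case True
      have "continuous_on (J \<times> {-1<..<1}) (\<lambda>p. P (snd p) (fst p))"
        unfolding P_def
        by (rule continuous_on_compose2[OF continuous_on_fibre_inverse[OF cont Q], where f = "\<lambda>p. (snd p, fst p)", simplified])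
          (auto intro!: continuous_intros)
      then have "continuous_on (J \<times> {-1<..<1}) (\<lambda>p. (f01 (snd p), P (snd p) (fst p)))"
        by (intro continuous_intros continuous_on_compose2[OF continuous_on_f01[of UNIV]]) auto
      then have "continuous_on (J \<times> {-1<..<1}) (\<lambda>p. Q (f01 (snd p)) (P (snd p) (fst p)))"
        by (rule continuous_on_compose2[OF cont, where f = "\<lambda>p. (f01 (snd p), P (snd p) (fst p))", simplified])
          (use P f01_open in auto)
      then have "continuous_on (J \<times> {-1<..<1}) (\<lambda>p. Q (f01 (snd p)) (P (snd p) (fst p)) - fst p)"
        by (intro continuous_intros)
      then have "continuous_on (J \<times> {-1<..<1}) E"
        by (rule continuous_on_eq) (auto simp: E_def h_def)
      then have "continuous (at p within J \<times> {-1<..<1}) E"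
        using p True by (auto simp: continuous_on_eq_continuous_within J2_def abs_less_iff)
      moreover have "at p within J \<times> {-1<..<1} = at p within J2"
        by (rule at_within_nhd[of _ "UNIV \<times> {-1<..<1}"])
          (use p True in \<open>auto simp: J2_def J_def intro: open_Times\<close>)
      ultimately show ?thesis by simp
    next
      case False
      then have p1: "\<bar>snd p\<bar> = 1"
        using p by (auto simp: J2_def J_def)
      then have "E p = 0"
        by (simp add: E_def h_def case_prod_beta)
      moreover have "(E \<longlongrightarrow> 0) (at p within J2)"
      proof (rule tendstoI)
        fix \<epsilon> :: real assume \<epsilon>: "\<epsilon> > 0"
        then obtain \<delta> where \<delta>: "\<delta> > 0"
            "\<And>s r. s \<in> {-1<..<1} \<Longrightarrow> 1 - \<delta> < \<bar>s\<bar> \<Longrightarrow> r \<in> J \<Longrightarrow> \<bar>Q (f01 s) r - Q s r\<bar> < \<epsilon>"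
          using lim by blast
        have "((\<lambda>q. \<bar>snd q\<bar>) \<longlongrightarrow> \<bar>snd p\<bar>) (at p within J2)"
          by (intro tendsto_intros)
        then have "\<forall>\<^sub>F q in at p within J2. 1 - \<delta> < \<bar>snd q\<bar>"
          using \<delta>(1) p1 by (intro order_tendstoD) auto
        moreover have "\<forall>\<^sub>F q in at p within J2. q \<in> J2"
          by (simp add: eventually_at_filter)
        ultimately show "\<forall>\<^sub>F q in at p within J2. dist (E q) 0 < \<epsilon>"
        proof eventually_elim
          case (elim q)
          obtain r s where q: "q = (r, s)" by force
          show ?case
          proof (cases "\<bar>s\<bar> < 1")
            case True
            then have s: "s \<in> {-1<..<1}" and r: "r \<in> J"
              using elim q by (auto simp: J2_def)
            show ?thesis
              using \<delta>(2)[OF s _ P(1)[OF s r]] P(2)[OF s r] elim q True by (simp add: E_def h_def)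
          qed (use \<epsilon> q in \<open>simp add: E_def h_def\<close>)
        qed
      qed
      ultimately show ?thesis
        by (simp add: continuous_within)
    qed
  qed
  then have "continuous_on J2 (\<lambda>p. ((\<lambda>(r, s). h s r - r) p + fst p, f01 (snd p)))"
    by (intro continuous_intros continuous_on_compose2[OF continuous_on_f01[of UNIV]]) auto
  then have "continuous_on J2 f"
    by (simp add: f_def case_prod_beta)
  moreover have "compact J2"
    unfolding J2_def J_def by (intro compact_Times) auto
  ultimately have "\<exists>g. homeomorphism J2 J2 f g"
    by (intro homeomorphism_compact)
  moreover have "f x = f02 x" if "x \<in> frontier J2" for x
  proof -
    obtain r s where x: "x = (r, s)" by force
    then have "\<bar>r\<bar> = 1 \<or> \<bar>s\<bar> = 1"
      using that frontier_J2 by auto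
    moreover have "r = 1 \<or> r = -1" if "\<bar>r\<bar> = 1"
      using that by linarith
    ultimately have "h s r = r"
      using h[of s] by (auto simp: incr_homeo_def h_def)
    then show ?thesis
      by (simp add: f_def f02_def x)
  qed
  ultimately have "normally_rising f"
    by (simp add: normally_rising_def f_level f02_level)
  moreover have "f (Q s r, s) = (Q (f01 s) r, f01 s)" if "s \<in> {-1<..<1}" "r \<in> J" for s r
    using that PQ[OF that] by (auto simp: f_def h_def)
  ultimately show ?thesis
    by blast
qed

subsection \<open>Limit sets and orbits of levels\<close>

text \<open>Links the subsequences in \<open>omega_limit\<close> to the \<epsilon>-form used in
  \<open>cluster_set\<close>. Indices with tolerance \<open>1 / (i + 1)\<close> are chosen one after
  another, each beyond the last.\<close>

lemma cluster_iff_subseq: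
  fixes u :: "nat \<Rightarrow> 'a::metric_space"
  shows "(\<exists>n. strict_mono n \<and> (\<forall>i. 0 < n i) \<and> (\<lambda>i. u (n i)) \<longlonglongrightarrow> y) \<longleftrightarrow>
    (\<forall>\<epsilon>>0. \<exists>\<^sub>F k in sequentially. dist (u k) y < \<epsilon>)"
proof
  assume "\<exists>n. strict_mono n \<and> (\<forall>i. 0 < n i) \<and> (\<lambda>i. u (n i)) \<longlonglongrightarrow> y"
  then obtain n :: "nat \<Rightarrow> nat" where n: "strict_mono n" "(\<lambda>i. u (n i)) \<longlonglongrightarrow> y"
    by blast
  show "\<forall>\<epsilon>>0. \<exists>\<^sub>F k in sequentially. dist (u k) y < \<epsilon>"
  proof (intro allI impI)
    fix \<epsilon> :: real assume "\<epsilon> > 0"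
    then obtain I where I: "\<And>i. i \<ge> I \<Longrightarrow> dist (u (n i)) y < \<epsilon>"
      using tendstoD[OF n(2)] unfolding eventually_sequentially by blast
    show "\<exists>\<^sub>F k in sequentially. dist (u k) y < \<epsilon>"
      unfolding frequently_sequentially
    proof
      fix K
      show "\<exists>k\<ge>K. dist (u k) y < \<epsilon>"
        using I[of "max I K"] seq_suble[OF n(1), of "max I K"] by (intro exI[of _ "n (max I K)"]) auto
    qed
  qed
next
  assume fr: "\<forall>\<epsilon>>0. \<exists>\<^sub>F k in sequentially. dist (u k) y < \<epsilon>"
  have step: "\<exists>k'>k. dist (u k') y < inverse (real (Suc i))" for k i
  proof -
    have "inverse (real (Suc i)) > 0"
      by simp
    then obtain k' where "k' \<ge> Suc k" "dist (u k') y < inverse (real (Suc i))"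
      using fr unfolding frequently_sequentially by blast
    then show ?thesis
      by (auto simp: Suc_le_eq)
  qed
  have "\<exists>n. \<forall>i. (0 < n i \<and> dist (u (n i)) y < inverse (real (Suc i))) \<and> n i < n (Suc i)"
  proof (rule dependent_nat_choice)
    show "\<exists>k. 0 < k \<and> dist (u k) y < inverse (real (Suc 0))"
      using step[of 0 0] by blast
    show "\<exists>k'. (0 < k' \<and> dist (u k') y < inverse (real (Suc (Suc i)))) \<and> k < k'" for k i
    proof -
      obtain k' where "k' > k" "dist (u k') y < inverse (real (Suc (Suc i)))"
        using step by blast
      then show ?thesis
        by (intro exI[of _ k']) linarith
    qed
  qed
  then obtain n where n: "\<And>i. 0 < n i" "\<And>i. dist (u (n i)) y < inverse (real (Suc i))" "\<And>i. n i < n (Suc i)"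
    by blast
  have "(\<lambda>i. u (n i)) \<longlonglongrightarrow> y"
    by (rule tendsto_dist_iff[THEN iffD2], rule Lim_null_comparison[OF _ LIMSEQ_inverse_real_of_nat])
      (use n(2) in \<open>auto intro!: always_eventually less_imp_le\<close>)
  then show "\<exists>n. strict_mono n \<and> (\<forall>i. 0 < n i) \<and> (\<lambda>i. u (n i)) \<longlonglongrightarrow> y"
    using n by (auto simp: strict_mono_Suc_iff)
qed

lemma cluster_set_Suc: "cluster_set (\<lambda>k. u (Suc k)) = cluster_set u"
proof -
  have "(\<exists>\<^sub>F k in sequentially. P (Suc k)) \<longleftrightarrow> (\<exists>\<^sub>F k in sequentially. P k)" for P
    using eventually_sequentially_Suc[of "\<lambda>k. \<not> P k"] by (simp add: frequently_def)
  from this[of "\<lambda>k. \<bar>u k - y\<bar> < \<epsilon>" for y \<epsilon>] show ?thesis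
    by (simp only: cluster_set_def)
qed

text \<open>The heights converge to \<open>c\<close> along every subsequence, so only the abscissas
  decide convergence.\<close>

lemma omega_limit_orbit:
  fixes u v :: "nat \<Rightarrow> real"
  assumes orbit: "\<And>k. (F ^^ k) x = (u k, v k)" and v: "v \<longlonglongrightarrow> c"
  shows "omega_limit F x = cluster_set u \<times> {c}"
proof (rule set_eqI)
  fix p :: "real \<times> real"
  obtain y d where p: "p = (y, d)" by force
  have v': "(\<lambda>i. v (n i)) \<longlonglongrightarrow> c" if "strict_mono n" for n
    using LIMSEQ_subseq_LIMSEQ[OF v that] by (simp add: o_def)
  have "p \<in> omega_limit F x \<longleftrightarrow>
      (\<exists>n. strict_mono n \<and> (\<forall>i. 0 < n i) \<and> (\<lambda>i. (u (n i), v (n i))) \<longlonglongrightarrow> (y, d))"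
    by (simp add: omega_limit_def orbit p)
  also have "\<dots> \<longleftrightarrow> (\<exists>n. strict_mono n \<and> (\<forall>i. 0 < n i) \<and> (\<lambda>i. u (n i)) \<longlonglongrightarrow> y) \<and> d = c"
  proof -
    have "(\<lambda>i. (u (n i), v (n i))) \<longlonglongrightarrow> (y, d) \<longleftrightarrow> (\<lambda>i. u (n i)) \<longlonglongrightarrow> y \<and> d = c"
      if n: "strict_mono n" for n :: "nat \<Rightarrow> nat"
    proof
      assume *: "(\<lambda>i. (u (n i), v (n i))) \<longlonglongrightarrow> (y, d)"
      show "(\<lambda>i. u (n i)) \<longlonglongrightarrow> y \<and> d = c"
        using tendsto_fst[OF *] tendsto_snd[OF *] LIMSEQ_unique[OF _ v'[OF n]] by simp
    next
      assume "(\<lambda>i. u (n i)) \<longlonglongrightarrow> y \<and> d = c"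
      then show "(\<lambda>i. (u (n i), v (n i))) \<longlonglongrightarrow> (y, d)"
        using tendsto_Pair v'[OF n] by auto
    qed
    then show ?thesis by blast
  qed
  also have "\<dots> \<longleftrightarrow> p \<in> cluster_set u \<times> {c}"
    unfolding cluster_iff_subseq by (simp add: p cluster_set_def dist_real_def)
  finally show "p \<in> omega_limit F x \<longleftrightarrow> p \<in> cluster_set u \<times> {c}" .
qed

section \<open>A time coordinate on levels in which the model map is the unit shift\<close>

definition level_time :: "real \<Rightarrow> real" where
  "level_time s = - log 2 (1 - s)"

lemma level_time_0 [simp]: "level_time 0 = 0"
  by (simp add: level_time_def)

text \<open>On \<open>[0, 1)\<close> the map \<open>f01\<close> halves the distance
  \<open>1 - s\<close>, hence the logarithm to base 2.\<close>

lemma level_time_f01: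
  assumes "0 \<le> s" "s < 1"
  shows "level_time (f01 s) = level_time s + 1"
proof -
  have "1 - f01 s = (1 - s) / 2"
    using assms by (simp add: f01_def field_simps)
  then have "level_time (f01 s) = - log 2 ((1 - s) / 2)"
    by (simp only: level_time_def)
  then show ?thesis
    using assms by (simp add: level_time_def log_divide)
qed

lemma level_time_funpow:
  assumes "0 \<le> s" "s < 1"
  shows "0 \<le> (f01 ^^ k) s \<and> (f01 ^^ k) s < 1 \<and> level_time ((f01 ^^ k) s) = level_time s + real k"
proof (induction k)
  case (Suc k)
  then show ?case
    by (simp add: level_time_f01 f01_strict f01_ge_0)
qed (use assms in simp)

lemma funpow_f01_tendsto:
  assumes "0 \<le> s" "s < 1"
  shows "(\<lambda>k. (f01 ^^ k) s) \<longlonglongrightarrow> 1"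
proof -
  have "(f01 ^^ k) s = 1 - (1 - s) * (1 / 2) ^ k" for k
  proof (induction k)
    case (Suc k)
    have "f01 ((f01 ^^ k) s) = ((f01 ^^ k) s + 1) / 2"
      using level_time_funpow[OF assms, of k] by (simp add: f01_nonneg)
    with Suc show ?case
      by simp
  qed simp
  moreover have "(\<lambda>k. 1 - (1 - s) * (1 / 2) ^ k) \<longlonglongrightarrow> 1 - (1 - s) * 0"
    by (intro tendsto_intros LIMSEQ_realpow_zero) auto
  ultimately show ?thesis
    by simp
qed

lemma level_time_le_1:
  assumes "s \<le> 1/2"
  shows "level_time s \<le> 1"
proof -
  have "log 2 (1 / 2) \<le> log 2 (1 - s)"
    using assms by (subst log_le_cancel_iff) auto
  then show ?thesis
    by (simp add: level_time_def log_divide)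
qed

lemma level_time_large:
  assumes "s < 1" "1 - 2 powr (- T) \<le> s"
  shows "T \<le> level_time s"
proof -
  have "log 2 (1 - s) \<le> log 2 (2 powr (- T))"
    using assms by (subst log_le_cancel_iff) auto
  then show ?thesis
    by (simp add: level_time_def)
qed

lemma continuous_on_level_time:
  assumes "S \<subseteq> {..<1}"
  shows "continuous_on S level_time"
  unfolding level_time_def[abs_def] using assms by (intro continuous_intros) auto

text \<open>The times fill only \<open>(0, 1]\<close> and \<open>[0, 1)\<close> respectively, and
  half-open unit intervals embed in the circle. The first domain serves the forward orbits, the
  second the reflected backward orbits.\<close>

lemma inj_on_cis_level_time:
  "inj_on (\<lambda>s. cis (2 * pi * level_time s)) {0<..1/2}"
  "inj_on (\<lambda>s. cis (2 * pi * level_time s)) {0..<1/2}"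
proof -
  have *: "s = t" if eq: "cis (2 * pi * level_time s) = cis (2 * pi * level_time t)"
    and st: "\<bar>level_time s - level_time t\<bar> < 1" "s < 1" "t < 1" for s t
  proof -
    obtain n :: int where n: "level_time s = level_time t + of_int n"
      using eq by (auto simp: cis_2pi_eq_iff)
    then have "n = 0" using st(1) by auto
    then show ?thesis
      using n st by (simp add: level_time_def log_def)
  qed
  have nonneg: "0 \<le> level_time s" if "0 \<le> s" "s < 1" for s
    using that by (simp add: level_time_def)
  have pos: "0 < level_time s" if "0 < s" "s < 1" for s
    using that by (simp add: level_time_def)
  have less: "level_time s < 1" if "s < 1/2" for s
  proof -
    have "log 2 (1 / 2) < log 2 (1 - s)"
      using that by (subst log_less_cancel_iff) auto
    then show ?thesis
      by (simp add: level_time_def log_divide)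
  qed
  show "inj_on (\<lambda>s. cis (2 * pi * level_time s)) {0<..1/2}"
  proof (rule inj_onI)
    fix s t :: real assume st: "s \<in> {0<..1/2}" "t \<in> {0<..1/2}"
      "cis (2 * pi * level_time s) = cis (2 * pi * level_time t)"
    moreover have "\<bar>level_time s - level_time t\<bar> < 1"
      using st pos[of s] pos[of t] level_time_le_1[of s] level_time_le_1[of t] by auto
    ultimately show "s = t"
      by (intro *) auto
  qed
  show "inj_on (\<lambda>s. cis (2 * pi * level_time s)) {0..<1/2}"
  proof (rule inj_onI)
    fix s t :: real assume st: "s \<in> {0..<1/2}" "t \<in> {0..<1/2}"
      "cis (2 * pi * level_time s) = cis (2 * pi * level_time t)"
    moreover have "\<bar>level_time s - level_time t\<bar> < 1"
      using st nonneg[of s] nonneg[of t] less[of s] less[of t] by auto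
    ultimately show "s = t"
      by (intro *) auto
  qed
qed

section \<open>Gluing the forward and backward isotopies, and the limit sets of the resulting
  map\<close>

theorem theorem1p1:
  fixes N1 N2 :: "nat set"
    and V W :: "nat \<Rightarrow> real set"
    and \<omega> \<alpha> :: "nat \<Rightarrow> real \<Rightarrow> (real \<times> real) set"
  assumes "N1 \<noteq> {}" and "N1 \<subseteq> {1..}"
    and "N2 \<noteq> {}" and "N2 \<subseteq> {1..}"
    and "disjoint_family_on V N1"
    and "\<And>n. n \<in> N1 \<Longrightarrow> V n \<noteq> {} \<and> connected (V n) \<and> V n \<subseteq> {0<..1/2}"
    and "disjoint_family_on W N2"
    and "\<And>j. j \<in> N2 \<Longrightarrow> W j \<noteq> {} \<and> connected (W j) \<and> W j \<subseteq> {0<..1/2}"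
    and "\<And>n. n \<in> N1 \<Longrightarrow>
           \<omega> n \<in> J \<rightarrow> level_continua 1 \<and> increasing_map (\<omega> n) \<and> endpoint_preserving 1 (\<omega> n)"
    and "\<And>j. j \<in> N2 \<Longrightarrow>
           \<alpha> j \<in> J \<rightarrow> level_continua (-1) \<and> increasing_map (\<alpha> j) \<and> endpoint_preserving (-1) (\<alpha> j)"
  shows "\<exists>f. normally_rising f \<and>
           (\<forall>n\<in>N1. \<forall>s\<in>V n. \<forall>r\<in>J. omega_slice s f r = \<omega> n r) \<and>
           (\<forall>j\<in>N2. \<forall>t\<in>W j. \<forall>r\<in>J. alpha_slice t f r = \<alpha> j r)"
proof -
  let ?S = "{0<..1/2} :: real set"
  have V: "connected (V n) \<and> V n \<subseteq> ?S" if "n \<in> N1" for n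
    using assms(6)[OF that] by blast
  have W: "connected (W n) \<and> W n \<subseteq> ?S" if "n \<in> N2" for n
    using assms(8)[OF that] by blast
  have "\<exists>G. slow_isotopy G \<and>
    (\<forall>n\<in>N1. \<forall>s\<in>V n. \<forall>r\<in>J. cluster_set (\<lambda>k. G (level_time s + real k) r) \<times> {1} = \<omega> n r)"
  proof (rule isotopy_with_limits[OF assms(5) V _ _ inj_on_cis_level_time(1) assms(9)])
    show "continuous_on ?S level_time"
      by (rule continuous_on_level_time) auto
  qed auto
  then obtain G1 where G1: "slow_isotopy G1"
      and G1_cluster: "\<And>n s r. n \<in> N1 \<Longrightarrow> s \<in> V n \<Longrightarrow> r \<in> J \<Longrightarrow>
        cluster_set (\<lambda>k. G1 (level_time s + real k) r) \<times> {1} = \<omega> n r"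
    by blast
  \<comment> \<open>For \<open>s\<close> in \<open>?S\<close> the first backward image is
    \<open>s - 1 / 2\<close>. Its reflection \<open>1 / 2 - s\<close> lies in
    \<open>{0..<1/2}\<close> and is the level whose time governs the backward orbit.\<close>
  have inj: "inj_on (\<lambda>s. cis (2 * pi * level_time (1 / 2 - s))) ?S"
  proof (rule inj_onI)
    fix s t :: real
    assume "s \<in> ?S" "t \<in> ?S"
      "cis (2 * pi * level_time (1 / 2 - s)) = cis (2 * pi * level_time (1 / 2 - t))"
    then have "1 / 2 - s = 1 / 2 - t"
      by (intro inj_onD[OF inj_on_cis_level_time(2)]) auto
    then show "s = t" by simp
  qed
  have cont: "continuous_on ?S (\<lambda>s. level_time (1 / 2 - s))"
    by (rule continuous_on_compose2[OF continuous_on_level_time[OF order_refl]])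
      (auto intro!: continuous_intros)
  have "\<exists>G. slow_isotopy G \<and> (\<forall>n\<in>N2. \<forall>s\<in>W n. \<forall>r\<in>J.
      cluster_set (\<lambda>k. G (level_time (1 / 2 - s) + real k) r) \<times> {-1} = \<alpha> n r)"
    by (rule isotopy_with_limits[OF assms(7) W _ cont inj assms(10)]) auto
  then obtain G2 where G2: "slow_isotopy G2"
      and G2_cluster: "\<And>n s r. n \<in> N2 \<Longrightarrow> s \<in> W n \<Longrightarrow> r \<in> J \<Longrightarrow>
        cluster_set (\<lambda>k. G2 (level_time (1 / 2 - s) + real k) r) \<times> {-1} = \<alpha> n r"
    by blast
  note G1 = slow_isotopyD[OF G1] and G2 = slow_isotopyD[OF G2]

  \<comment> \<open>\<open>G1\<close> acts above and \<open>G2\<close>, reflected, below; both are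
    the identity for \<open>\<bar>s\<bar> \<le> 1/2\<close>, so they fit together at level
    0.\<close>
  define Q where "Q = (\<lambda>s r. if s \<le> 0 then G2 (level_time (- s)) r else G1 (level_time s) r)"
  have Q_homeo: "incr_homeo (Q s)" for s
    using G1(2) G2(2) by (cases "s \<le> 0") (auto simp: Q_def)
  have Q_id: "Q s r = r" if "\<bar>s\<bar> \<le> 1/2" for s r
    using that by (auto simp: Q_def G1(3) G2(3) level_time_le_1)
  have Q_pos: "Q s r = G1 (level_time s) r" if "0 \<le> s" for s r
    using that by (cases "s = 0") (auto simp: Q_def G1(3) G2(3))
  have Q_neg: "Q (- s) r = G2 (level_time s) r" if "0 \<le> s" for s r
    using that by (simp add: Q_def)
  have "continuous_on ({-1<..<1} \<times> J) (\<lambda>p. if fst p \<le> 0 then G2 (level_time (- fst p)) (snd p)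
      else G1 (level_time (fst p)) (snd p))"
  proof (rule continuous_on_cases_le)
    show "continuous_on {p \<in> {-1<..<1} \<times> J. fst p \<le> 0} (\<lambda>p. G2 (level_time (- fst p)) (snd p))"
      by (rule continuous_on_compose2[OF G2(1), where f = "\<lambda>p. (level_time (- fst p), snd p)", simplified])
        (auto intro!: continuous_intros continuous_on_compose2[OF continuous_on_level_time[OF order_refl]])
    show "continuous_on {p \<in> {-1<..<1} \<times> J. 0 \<le> fst p} (\<lambda>p. G1 (level_time (fst p)) (snd p))"
      by (rule continuous_on_compose2[OF G1(1), where f = "\<lambda>p. (level_time (fst p), snd p)", simplified])
        (auto intro!: continuous_intros continuous_on_compose2[OF continuous_on_level_time[OF order_refl]])
  qed (auto simp: G1(3) G2(3) intro!: continuous_intros)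
  then have Q_cont: "continuous_on ({-1<..<1} \<times> J) (\<lambda>(s, r). Q s r)"
    by (simp add: Q_def case_prod_beta)
  have Q_lim: "\<exists>\<delta>>0. \<forall>s\<in>{-1<..<1}. 1 - \<delta> < \<bar>s\<bar> \<longrightarrow> (\<forall>r\<in>J. \<bar>Q (f01 s) r - Q s r\<bar> < \<epsilon>)"
    if \<epsilon>: "\<epsilon> > 0" for \<epsilon>
  proof -
    define T where "T = 2 / \<epsilon> + 1"
    have T: "T \<ge> 1"
      using \<epsilon> by (simp add: T_def)
    have T_bound: "2 / t < \<epsilon>" if "t \<ge> T" for t
    proof -
      have "2 / \<epsilon> < t" using that by (simp add: T_def)
      moreover have "0 < t" using that T by linarith
      ultimately show ?thesis using \<epsilon> by (simp add: field_simps)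
    qed
    \<comment> \<open>Heights beyond \<open>1 - \<delta>\<close> have time at least
      \<open>T + 1\<close>. The extra unit is spent on the lower half, where \<open>f01\<close>
      moves towards level 0 and lowers the time by 1.\<close>
    define \<delta> where "\<delta> = 2 powr (- (T + 1))"
    have "\<delta> \<le> 2 powr (- 1)"
      unfolding \<delta>_def using T by (intro powr_mono) auto
    then have \<delta>: "\<delta> \<le> 1 / 2"
      by (simp add: powr_minus)
    have "\<bar>Q (f01 s) r - Q s r\<bar> < \<epsilon>"
      if s: "s \<in> {-1<..<1}" "1 - \<delta> < \<bar>s\<bar>" and r: "r \<in> J" for s r
    proof (cases "0 \<le> s")
      case True
      have "T + 1 \<le> level_time s"
        using s True by (intro level_time_large) (auto simp: \<delta>_def)
      then have "\<bar>G1 (level_time s + 1) r - G1 (level_time s) r\<bar> < \<epsilon>"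
        using G1(4)[of "level_time s" r] T T_bound[of "level_time s"] r by force
      then show ?thesis
        using True s by (simp add: Q_pos level_time_f01 f01_ge_0)
    next
      case False
      \<comment> \<open>Thus \<open>- s = f01 x\<close>, and one step of \<open>f01\<close> at
        \<open>s\<close> runs \<open>G2\<close> backwards by one unit. As \<delta> is at most
        \<open>1 / 2\<close>, \<open>s < - 1 / 2\<close> and so \<open>x\<close> is
        nonnegative.\<close>
      define x where "x = - f01 s"
      have x: "0 \<le> x" "x < 1" "s = - f01 x"
        using False s \<delta> minus_f01_f01[of s] f01_strict(2)[of s] by (auto simp: x_def) (auto simp: f01_def)
      have "T + 1 \<le> level_time (f01 x)"
        using s x False by (intro level_time_large) (auto simp: \<delta>_def)
      then have "T \<le> level_time x"
        using x by (simp add: level_time_f01)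
      then have "\<bar>G2 (level_time x + 1) r - G2 (level_time x) r\<bar> < \<epsilon>"
        using G2(4)[of "level_time x" r] T T_bound[of "level_time x"] r by force
      moreover have "Q s r = G2 (level_time x + 1) r"
        using x by (simp add: Q_neg level_time_f01 f01_ge_0)
      moreover have "Q (f01 s) r = G2 (level_time x) r"
        using Q_neg[OF x(1)] by (simp add: x_def)
      ultimately show ?thesis
        by (simp add: abs_minus_commute)
    qed
    then show ?thesis
      by (intro exI[of _ \<delta>]) (auto simp: \<delta>_def)
  qed
  obtain f where f: "normally_rising f"
      and f_Q: "\<And>s r. s \<in> {-1<..<1} \<Longrightarrow> r \<in> J \<Longrightarrow> f (Q s r, s) = (Q (f01 s) r, f01 s)"
    using normally_rising_conjugate[OF Q_cont Q_homeo Q_lim] by blast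

  have omega: "omega_slice s f r = \<omega> n r" if n: "n \<in> N1" "s \<in> V n" "r \<in> J" for n s r
  proof -
    have s: "0 < s" "s \<le> 1/2"
      using subsetD[OF conjunct2[OF V[OF n(1)]] n(2)] by auto
    then have s': "0 \<le> s" "s < 1" by auto
    \<comment> \<open>The orbit starts at \<open>(Q s r, s)\<close>, because \<open>Q s\<close> is
      the identity at this height.\<close>
    have "(f ^^ k) (r, s) = (G1 (level_time s + real k) r, (f01 ^^ k) s)" for k
    proof -
      have "(f ^^ k) (r, s) = (Q ((f01 ^^ k) s) r, (f01 ^^ k) s)"
      proof (induction k)
        case 0
        show ?case using s by (simp add: Q_id)
      next
        case (Suc k)
        then show ?case
          using level_time_funpow[OF s', of k] n(3) by (simp add: f_Q)
      qed
      then show ?thesis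
        using level_time_funpow[OF s', of k] by (simp add: Q_pos)
    qed
    then show ?thesis
      using G1_cluster[OF n] omega_limit_orbit[OF _ funpow_f01_tendsto[OF s']] by (simp add: omega_slice_def)
  qed

  define g where "g = inv_into J2 f"
  define g01 where "g01 = (\<lambda>s. - f01 (- s))"
  have "inj_on f J2"
    using f by (auto simp: normally_rising_def homeomorphism_def intro: inj_on_inverseI)
  have g_Q: "g (Q s r, s) = (Q (g01 s) r, g01 s)" if "s \<in> {-1<..<1}" "r \<in> J" for s r
  proof -
    have "g01 s \<in> {-1<..<1}"
      using that(1) f01_strict[of "- s"] by (auto simp: g01_def)
    moreover from this have "(Q (g01 s) r, g01 s) \<in> J2"
      using incr_homeo_mem[OF Q_homeo that(2)] by (simp add: J2_def J_def)
    moreover have "f01 (g01 s) = s"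
      by (simp add: g01_def)
    ultimately show ?thesis
      using f_Q[of "g01 s" r] that(2) inv_into_f_f[OF \<open>inj_on f J2\<close>, of "(Q (g01 s) r, g01 s)"]
      by (simp add: g_def)
  qed
  have alpha: "alpha_slice s f r = \<alpha> n r" if n: "n \<in> N2" "s \<in> W n" "r \<in> J" for n s r
  proof -
    have s: "0 < s" "s \<le> 1/2"
      using subsetD[OF conjunct2[OF W[OF n(1)]] n(2)] by auto
    define x where "x = 1 / 2 - s"
    have x: "0 \<le> x" "x < 1"
      using s by (auto simp: x_def)
    have "g01 s = - x"
      using s by (simp add: g01_def f01_def x_def)
    moreover have "(g01 ^^ k) (- x) = - (f01 ^^ k) x" for k
      by (induction k) (simp_all add: g01_def)
    \<comment> \<open>After one backward step the heights are the negatives of the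
      \<open>f01\<close>-orbit of \<open>x\<close>, hence the index shift.\<close>
    ultimately have g01_Suc: "(g01 ^^ Suc k) s = - (f01 ^^ k) x" for k
      by (simp add: funpow_Suc_right del: funpow.simps)
    have "(g01 ^^ k) s \<in> {-1<..<1}" for k
    proof (cases k)
      case (Suc k')
      then show ?thesis
        using g01_Suc[of k'] level_time_funpow[OF x, of k'] by simp
    qed (use s in simp)
    then have orbit: "(g ^^ k) (r, s) = (Q ((g01 ^^ k) s) r, (g01 ^^ k) s)" for k
      by (induction k) (use s n(3) in \<open>simp_all add: Q_id g_Q\<close>)
    have "(\<lambda>k. (g01 ^^ Suc k) s) \<longlonglongrightarrow> -1"
      unfolding g01_Suc using funpow_f01_tendsto[OF x] by (rule tendsto_minus)
    then have "(\<lambda>k. (g01 ^^ k) s) \<longlonglongrightarrow> -1"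
      by (rule LIMSEQ_imp_Suc)
    \<comment> \<open>Dropping the initial point, whose height is positive, leaves the cluster set
      unchanged and only heights at which \<open>G2\<close> describes \<open>Q\<close>.\<close>
    then have "alpha_slice s f r = cluster_set (\<lambda>k. Q ((g01 ^^ Suc k) s) r) \<times> {-1}"
      using omega_limit_orbit[OF orbit] cluster_set_Suc[of "\<lambda>k. Q ((g01 ^^ k) s) r"]
      by (simp add: alpha_slice_def alpha_limit_def g_def)
    also have "(\<lambda>k. Q ((g01 ^^ Suc k) s) r) = (\<lambda>k. G2 (level_time x + real k) r)"
      unfolding g01_Suc using level_time_funpow[OF x] by (simp add: Q_neg)
    finally show ?thesis
      using G2_cluster[OF n] by (simp add: x_def)
  qed
  from f omega alpha show ?thesis
    by blast
qed

end
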